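(* Let $p$ be an odd prime and $n\ge1$ an integer. Let $G=(\mathbb{F}_{p^n}^*,\cdot)\times(\mathbb{F}_p,+)$, $N_2=\mathbb{F}_{p^n}^*\times\{0\}$ and $N_1=\{1\}\times\mathbb{F}_p$, and let $D\subseteq G$ be a generalized difference set with parameters $(p(p^n-1);\,p,\,p^n-1;\,p^n-1,\,p^{n-1};\,0,\,p^{n-1}-1)$ relative to $N_1$ and $N_2$. For $i=1,\dots,p-1$ let $t_i:=p+i(p^n-1)$. Then each $(1,t_i)$, $i=1,\dots,p-1$, is a numerical multiplier of $D$; that is, for each such $i$ there exists $g\in G$ with $D^{(1,t_i)}=gD$.
   Context: Generalized difference set: let $G$ be a finite abelian group of order $v$ (written multiplicatively) and $N_1,N_2$ subgroups of orders $n_1,n_2$ intersecting trivially. A $k$-subset $D$ of $G$ is a $(v;n_1,n_2;k,\lambda;\lambda_1,\lambda_2)$ generalized difference set relative to $N_1,N_2$ if the list of $d_1d_2^{-1}$ with $d_1,d_2\in D$, $d_1\neq d_2$, contains each element of $G\setminus(N_1\cup N_2)$ exactly $\lambda$ times and each non-identity element of $N_i$ exactly $\lambda_i$ times ($i=1,2$). For $D\subseteq(\mathbb{F}_{p^n}^*,\cdot)\times(\mathbb{F}_p,+)$ and an integer $t$: $D^{(1,t)}=\{(x,t\cdot y):(x,y)\in D\}$, and for $g=(h_1,h_2)\in G$: $gD=\{(h_1x,y+h_2):(x,y)\in D\}$. *)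

theory Defs
  imports "HOL-Algebra.Algebra"
begin

definition generalized_difference_set ::
  "('a, 'm) monoid_scheme \<Rightarrow> 'a set \<Rightarrow> 'a set \<Rightarrow>
   nat \<Rightarrow> nat \<Rightarrow> nat \<Rightarrow> nat \<Rightarrow> nat \<Rightarrow> nat \<Rightarrow> nat \<Rightarrow> 'a set \<Rightarrow> bool"
where
  "generalized_difference_set G N1 N2 v n1 n2 k l l1 l2 D \<longleftrightarrow>
     comm_group G \<and> finite (carrier G) \<and> order G = v \<and>
     subgroup N1 G \<and> card N1 = n1 \<and>
     subgroup N2 G \<and> card N2 = n2 \<and>
     N1 \<inter> N2 = {\<one>\<^bsub>G\<^esub>} \<and>
     D \<subseteq> carrier G \<and> card D = k \<and>
     (let mult_in_list = (\<lambda>g. card {(d1, d2). d1 \<in> D \<and> d2 \<in> D \<and> d1 \<noteq> d2 \<and>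
                                         d1 \<otimes>\<^bsub>G\<^esub> inv\<^bsub>G\<^esub> d2 = g})
      in (\<forall>g \<in> carrier G - (N1 \<union> N2). mult_in_list g = l) \<and>
         (\<forall>g \<in> N1 - {\<one>\<^bsub>G\<^esub>}. mult_in_list g = l1) \<and>
         (\<forall>g \<in> N2 - {\<one>\<^bsub>G\<^esub>}. mult_in_list g = l2))"

text \<open>The group \<open>(K\<^sup>*, \<cdot>) \<times> (F, +)\<close>; its operation is
  \<open>(h\<^sub>1, h\<^sub>2) \<otimes> (x, y) = (h\<^sub>1 x, h\<^sub>2 + y)\<close>.\<close>

definition mult_add_group ::
  "('a, 'm) ring_scheme \<Rightarrow> ('b, 'n) ring_scheme \<Rightarrow> ('a \<times> 'b) monoid"
where
  "mult_add_group K F = mult_of K \<times>\<times> add_monoid F"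

definition scale_second :: "('b, 'n) ring_scheme \<Rightarrow> int \<Rightarrow> ('a \<times> 'b) set \<Rightarrow> ('a \<times> 'b) set"
where
  "scale_second F t D = (\<lambda>(x, y). (x, [t] \<cdot>\<^bsub>F\<^esub> y)) ` D"

text \<open>\<open>(1, t)\<close> is a numerical multiplier of \<open>D\<close>; the translate \<open>gD\<close> is the left coset
  \<open>g <# D\<close> (defined for arbitrary subsets).\<close>

definition numerical_multiplier_1 ::
  "('a, 'm) ring_scheme \<Rightarrow> ('b, 'n) ring_scheme \<Rightarrow> int \<Rightarrow> ('a \<times> 'b) set \<Rightarrow> bool"
where
  "numerical_multiplier_1 K F t D \<longleftrightarrow>
     (\<exists>g \<in> carrier (mult_add_group K F).
        scale_second F t D = g <#\<^bsub>mult_add_group K F\<^esub> D)"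

end

(* Since lambda_1 = 0, D meets every coset of N_1 at most once, and G is cyclic of order p m with
m = p^n - 1. In T = Z[X]/(Psi), Psi = 1 + X^m + ... + X^(m(p-1)), i.e. the group ring of G modulo
the sum over N_1, let theta and theta' be the images of D and D^(-1). The parameters say
theta theta' = p^n - N_2. With pi = 1 - X^m, p equals -pi^(p-1) up to a factor congruent to 1
mod pi, and every element of T/pi satisfies z^(p^n) = z. The substitution sigma: X -> X^s, with
s = 1 mod m and s = t mod p, is the identity mod pi. As p is totally ramified in Q(zeta_p), sigma
preserves the pi-adic valuation at every prime, so after removing the trivial character of N_2 the
product sigma(theta) theta' is still divisible by p^n. An induction on the exponent of pi replaces
primes and localisations in this argument.

Hence the coefficients of sigma(theta) theta', corrected by one on a single coset of N_2, are
congruent mod p^n along each coset of N_1. They are nonnegative with sum p^n, so they are either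
all equal to p^(n-1) or a single one equals p^n. The former cannot happen on all cosets because
sigma(theta) theta' would vanish at the characters that are nontrivial on N_2; the latter says
that D^(1,t) is a translate of D. *)
theory Submission
  imports Defs "HOL-Computational_Algebra.Polynomial_Factorial" "HOL-Number_Theory.Cong"
begin

section \<open>A divisibility form of the multiplier theorem\<close>

text \<open>When \<open>a\<close> is a multiple of \<open>\<pi>\<close>, the truncated geometric
  series inverts \<open>1 - a\<close> modulo \<open>\<pi> ^ m\<close>.\<close>

lemma geometric_unit_mod_power:
  fixes a :: "'r::comm_ring_1"
  shows "\<exists>u. (1 - a) * u = 1 - a ^ m"
  using one_diff_power_eq[of a m] by metis

lemma dvd_diffE:
  fixes a b d :: "'r::comm_ring_1"
  assumes "d dvd a - b"
  obtains k where "a = b + d * k"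
  using assms by (metis dvdE add.commute diff_add_cancel)

text \<open>With \<open>q = r + 2\<close> and \<open>h = 1 - x ^ (q - 1)\<close>, the product \<open>h * x\<close> is a multiple of \<open>\<pi>\<close>, so
  that the induction applies to \<open>h * x / \<pi>\<close>; on the complement \<open>1 - h = x ^ (q - 1)\<close> the factor
  \<open>\<pi> ^ M\<close> already divides \<open>y\<close>.\<close>

lemma multiplier_divisibility:
  fixes \<Psi> \<pi> :: "'r::comm_ring_1" and \<sigma> :: "'r \<Rightarrow> 'r"
  assumes reg: "\<And>a. \<Psi> dvd \<pi> * a \<Longrightarrow> \<Psi> dvd a"
    and frob: "\<And>x. \<exists>w. \<Psi> dvd x ^ Suc (Suc r) - x - \<pi> * w"
    and \<sigma>_diff: "\<And>x y. \<sigma> (x - y) = \<sigma> x - \<sigma> y"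
    and \<sigma>_mult: "\<And>x y. \<sigma> (x * y) = \<sigma> x * \<sigma> y"
    and \<sigma>_\<Psi>: "\<Psi> dvd \<sigma> \<Psi>"
    and \<sigma>_cong: "\<And>x. \<pi> dvd \<sigma> x - x"
    and xy: "\<Psi> dvd x * y - g * \<pi> ^ M"
  shows "\<exists>w. \<Psi> dvd g * \<sigma> x * y - \<pi> ^ M * w"
  using xy
proof (induction M arbitrary: x g)
  case 0
  show ?case by (rule exI[of _ "g * \<sigma> x * y"]) simp
next
  case (Suc M)
  \<comment> \<open>Membership in the ideal generated by \<open>\<pi> ^ Suc M\<close> and
    \<open>\<Psi>\<close>; the goal is \<open>I (g * \<sigma> x * y)\<close>.\<close>
  define I where "I = (\<lambda>A. \<exists>w k. A = \<pi> ^ Suc M * w + \<Psi> * k)"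
  have I_add: "I (A + B)" if "I A" "I B" for A B
  proof -
    obtain w k w' k' where "A = \<pi> ^ Suc M * w + \<Psi> * k" "B = \<pi> ^ Suc M * w' + \<Psi> * k'"
      using \<open>I A\<close> \<open>I B\<close> unfolding I_def by blast
    then have "A + B = \<pi> ^ Suc M * (w + w') + \<Psi> * (k + k')" by (simp only: algebra_simps)
    then show ?thesis unfolding I_def by blast
  qed
  have I_mult: "I (c * A)" if "I A" for A c
  proof -
    obtain w k where "A = \<pi> ^ Suc M * w + \<Psi> * k" using \<open>I A\<close> unfolding I_def by blast
    then have "c * A = \<pi> ^ Suc M * (c * w) + \<Psi> * (c * k)" by (simp only: algebra_simps)
    then show ?thesis unfolding I_def by blast
  qed
  have I_pi: "I (\<pi> ^ Suc M * w)" for w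
    unfolding I_def by (rule exI[of _ w], rule exI[of _ 0]) simp
  obtain k where k: "x * y = g * \<pi> ^ Suc M + \<Psi> * k"
    using Suc.prems by (rule dvd_diffE)
  define e where "e = x ^ Suc r"
  define h where "h = 1 - e"
  have "e = 1 - h" unfolding h_def by simp
  obtain w l where wl: "x ^ Suc (Suc r) - x - \<pi> * w = \<Psi> * l" using frob by (blast elim: dvdE)
  have hx: "h * x = \<pi> * (- w) - \<Psi> * l"
    using wl unfolding h_def e_def by (simp add: algebra_simps)
  \<comment> \<open>Multiplying \<open>x * y = g * \<pi> ^ Suc M\<close> by \<open>h\<close> leaves
    a factor \<open>\<pi>\<close> on both sides modulo \<open>\<Psi>\<close>. Cancelling it makes
    the induction hypothesis available for \<open>- w\<close> and \<open>h * g\<close>.\<close>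
  have "\<pi> * (- w * y - h * g * \<pi> ^ M) = (\<pi> * (- w)) * y - h * (g * \<pi> ^ Suc M)"
    by (simp add: algebra_simps)
  also have "\<dots> = (h * x + \<Psi> * l) * y - h * (x * y - \<Psi> * k)"
    unfolding hx k by simp
  also have "\<dots> = \<Psi> * (l * y + h * k)" by (simp add: algebra_simps)
  finally have "\<Psi> dvd - w * y - (h * g) * \<pi> ^ M"
    by (intro reg[OF dvdI])
  from Suc.IH[OF this] obtain w1 k1 where w1: "h * g * \<sigma> (- w) * y = \<pi> ^ M * w1 + \<Psi> * k1"
    by (blast elim: dvd_diffE)
  obtain c where c: "\<sigma> \<pi> = \<pi> + \<pi> * c" using \<sigma>_cong by (rule dvd_diffE)
  obtain d where d: "\<sigma> \<Psi> = \<Psi> * d" using \<sigma>_\<Psi> by (rule dvdE)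
  obtain b where b: "\<sigma> h = h + \<pi> * b" using \<sigma>_cong by (rule dvd_diffE)
  define A where "A = g * \<sigma> x * y"
  \<comment> \<open>The cancelled factor returns, because \<open>\<sigma> \<pi>\<close> is again a
    multiple of \<open>\<pi>\<close>.\<close>
  have hx': "\<sigma> h * \<sigma> x = (\<pi> + \<pi> * c) * \<sigma> (- w) - \<Psi> * d * \<sigma> l"
    using arg_cong[OF hx, of \<sigma>] by (simp only: \<sigma>_mult \<sigma>_diff c d)
  have "\<sigma> h * (h * A) = (\<sigma> h * \<sigma> x) * (h * g * y)"
    unfolding A_def by (simp add: algebra_simps)
  also have "\<dots> = (\<pi> + \<pi> * c) * (h * g * \<sigma> (- w) * y) + \<Psi> * (- d * \<sigma> l * h * g * y)"
    unfolding hx' by (simp add: algebra_simps)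
  also have "\<dots> = \<pi> ^ Suc M * ((1 + c) * w1) + \<Psi> * ((\<pi> + \<pi> * c) * k1 - d * \<sigma> l * h * g * y)"
    unfolding w1 by (simp add: algebra_simps)
  finally have 1: "I (\<sigma> h * (h * A))" unfolding I_def by blast
  have "e * A = g * \<sigma> x * x ^ r * (x * y)"
    unfolding e_def A_def by (simp add: algebra_simps)
  also have "\<dots> = \<pi> ^ Suc M * (g * \<sigma> x * x ^ r * g) + \<Psi> * (g * \<sigma> x * x ^ r * k)"
    unfolding k by (simp only: algebra_simps)
  finally have 2: "I (e * A)" unfolding I_def by blast
  \<comment> \<open>The two memberships combine through
    \<open>\<sigma> h * h + (\<sigma> h + 1) * (1 - h) = 1 + \<pi> * b\<close>, a unit modulo
    \<open>\<pi> ^ Suc M\<close>.\<close>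
  have "(1 - (- (\<pi> * b))) * A = \<sigma> h * (h * A) + (\<sigma> h + 1) * (e * A)"
    unfolding b \<open>e = 1 - h\<close> by (simp add: algebra_simps)
  then have 3: "I ((1 - (- (\<pi> * b))) * A)" by (metis 1 2 I_add I_mult)
  obtain u where u: "(1 - (- (\<pi> * b))) * u = 1 - (- (\<pi> * b)) ^ Suc M"
    using geometric_unit_mod_power by blast
  have "A = u * ((1 - (- (\<pi> * b))) * A) + \<pi> ^ Suc M * ((- b) ^ Suc M * A)"
  proof -
    have "(- (\<pi> * b)) ^ Suc M = \<pi> ^ Suc M * (- b) ^ Suc M"
      by (metis mult_minus_right power_mult_distrib)
    then have E: "u * ((1 - (- (\<pi> * b))) * A) = (1 - \<pi> ^ Suc M * (- b) ^ Suc M) * A"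
      using u by (metis mult.assoc mult.commute)
    show ?thesis unfolding E by (simp only: left_diff_distrib mult.assoc mult_1_left diff_add_cancel)
  qed
  then have "I A" by (metis 3 I_add I_mult I_pi)
  then show ?case unfolding I_def A_def by (metis add_diff_cancel_left' dvd_triv_left)
qed

section \<open>Frobenius congruences and the expansion of a geometric sum\<close>

lemma prime_dvd_binomial_power_sum:
  fixes x y :: "'r::comm_ring_1"
  assumes "Factorial_Ring.prime p"
  shows "of_nat p dvd (x + y) ^ p - (x ^ p + y ^ p)"
proof -
  have p: "p > 0" using assms by (rule prime_gt_0_nat)
  define f where "f = (\<lambda>k. of_nat (p choose k) * x ^ k * y ^ (p - k))"
  have "(x + y) ^ p = (\<Sum>k\<le>p. f k)" unfolding f_def by (rule binomial_ring)
  also have "{..p} = insert 0 (insert p {1..<p})" using p by auto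
  also have "sum f \<dots> = f 0 + (f p + sum f {1..<p})" using p by simp
  finally have "(x + y) ^ p - (x ^ p + y ^ p) = sum f {1..<p}" by (simp add: f_def)
  moreover have "of_nat p dvd f k" if "k \<in> {1..<p}" for k
  proof -
    have "p dvd p choose k" using that assms by (intro dvd_choose_prime) auto
    then have "(of_nat p :: 'r) dvd of_nat (p choose k)" by (metis dvdE dvd_triv_left of_nat_mult)
    then show ?thesis unfolding f_def by (simp add: mult.assoc)
  qed
  ultimately show ?thesis by (metis dvd_sum)
qed

lemma dvd_power_diff:
  fixes a b :: "'r::comm_ring_1"
  assumes "d dvd a - b" shows "d dvd a ^ k - b ^ k"
  using assms by (simp add: power_diff_sumr2)

lemma prime_dvd_frobenius_add:
  fixes x y :: "'r::comm_ring_1"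
  assumes "Factorial_Ring.prime p"
  shows "of_nat p dvd (x + y) ^ (p ^ n) - (x ^ (p ^ n) + y ^ (p ^ n))"
proof (induction n)
  case (Suc n)
  let ?s = "x ^ (p ^ n) + y ^ (p ^ n)"
  have "(x + y) ^ (p ^ Suc n) - (x ^ (p ^ Suc n) + y ^ (p ^ Suc n)) =
    (((x + y) ^ (p ^ n)) ^ p - ?s ^ p) + (?s ^ p - ((x ^ (p ^ n)) ^ p + (y ^ (p ^ n)) ^ p))"
    by (simp add: power_mult [symmetric] mult.commute)
  then show ?case
    using dvd_power_diff[OF Suc.IH, of p] prime_dvd_binomial_power_sum[OF assms] by (metis dvd_add)
qed simp

text \<open>Expand \<open>1 - (1 - \<pi>) ^ p\<close> and divide by \<open>\<pi>\<close>: the linear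
  term gives \<open>p\<close>, the last one gives \<open>\<pi> ^ (p - 1)\<close> with a plus sign
  since \<open>p\<close> is odd, and the others are multiples of \<open>p * \<pi>\<close>.\<close>

lemma geometric_sum_uniformizer:
  fixes \<pi> :: "'r::idom"
  assumes p: "Factorial_Ring.prime p" "odd p" and "\<pi> \<noteq> 0"
  shows "\<exists>z. (\<Sum>i<p. (1 - \<pi>) ^ i) = of_nat p * (1 - \<pi> * z) + \<pi> ^ (p - 1)"
proof -
  have p3: "p \<ge> 3" using prime_gt_1_nat[OF p(1)] p(2) by (cases "p = 2") auto
  define f where "f = (\<lambda>k. of_nat (p choose k) * (- \<pi>) ^ k * 1 ^ (p - k))"
  have "(1 - \<pi>) ^ p = (- \<pi> + 1) ^ p" by simp
  also have "\<dots> = (\<Sum>k\<le>p. f k)" unfolding f_def by (rule binomial_ring)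
  also have "{..p} = insert 0 (insert 1 (insert p {2..<p}))" using p3 by auto
  also have "sum f \<dots> = 1 + (- (of_nat p * \<pi>) + (- (\<pi> ^ p) + sum f {2..<p}))"
    using p3 p(2) by (simp add: f_def)
  finally have 1: "(1 - \<pi>) ^ p = 1 + (- (of_nat p * \<pi>) + (- (\<pi> ^ p) + sum f {2..<p}))" .
  have "of_nat p * \<pi> ^ 2 dvd f k" if "k \<in> {2..<p}" for k
  proof -
    have "p dvd p choose k" using that p by (intro dvd_choose_prime) auto
    then have "(of_nat p :: 'r) dvd of_nat (p choose k)" by (metis dvdE dvd_triv_left of_nat_mult)
    moreover have "\<pi> ^ 2 dvd (- \<pi>) ^ k"
      using that by (metis atLeastLessThan_iff le_imp_power_dvd power2_minus)
    ultimately show ?thesis unfolding f_def by (simp add: mult_dvd_mono)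
  qed
  then have "of_nat p * \<pi> ^ 2 dvd sum f {2..<p}" by (rule dvd_sum)
  then obtain z where z: "sum f {2..<p} = of_nat p * \<pi> ^ 2 * z" by (rule dvdE)
  have "\<pi> * (\<Sum>i<p. (1 - \<pi>) ^ i) = 1 - (1 - \<pi>) ^ p"
    using one_diff_power_eq[of "1 - \<pi>" p] by simp
  also have "\<dots> = of_nat p * \<pi> + \<pi> ^ p - of_nat p * \<pi> ^ 2 * z" unfolding 1 z by simp
  also have "\<pi> ^ p = \<pi> * \<pi> ^ (p - 1)" using p3 by (simp add: power_eq_if)
  also have "of_nat p * \<pi> + \<pi> * \<pi> ^ (p - 1) - of_nat p * \<pi> ^ 2 * z =
    \<pi> * (of_nat p * (1 - \<pi> * z) + \<pi> ^ (p - 1))"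
    by (simp add: algebra_simps power2_eq_square)
  finally show ?thesis using \<open>\<pi> \<noteq> 0\<close> by (metis mult_left_cancel)
qed

section \<open>Integer polynomials modulo a sum of roots of unity\<close>

definition indeterminate :: "int poly" ("\<xi>") where "\<xi> = [:0, 1:]"

lemma pCons_conv_indeterminate: "pCons c f = [:c:] + \<xi> * f"
  by (simp add: indeterminate_def)

text \<open>With X standing for a generator of G, \<open>cyc_sum m p\<close> is the sum \<Psi> over
  N_1 and \<open>cyc_sum p m\<close> is the sum over N_2.\<close>

definition cyc_sum :: "nat \<Rightarrow> nat \<Rightarrow> int poly" where
  "cyc_sum m k = (\<Sum>i<k. \<xi> ^ (m * i))"

lemma cyc_sum_mult: "cyc_sum m k * (1 - \<xi> ^ m) = 1 - \<xi> ^ (m * k)"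
  unfolding cyc_sum_def power_mult by (subst mult.commute) (rule one_diff_power_eq [symmetric])

lemma coeff_indeterminate_power: "poly.coeff (\<xi> ^ k) j = of_bool (j = k)"
  by (induction k arbitrary: j) (auto simp: indeterminate_def coeff_pCons split: nat.splits)

lemma one_minus_indeterminate_power_nonzero: "m > 0 \<Longrightarrow> 1 - \<xi> ^ m \<noteq> 0"
  using coeff_indeterminate_power[of m m] by (auto dest: arg_cong[of _ _ "\<lambda>f. poly.coeff f m"])

lemma prime_elem_of_nat_poly:
  assumes "Factorial_Ring.prime p"
  shows "Factorial_Ring.prime_elem (of_nat p :: int poly)"
  using assms by (simp add: of_nat_poly prime_elem_const_poly_iff)

lemma cyc_sum_uniformizer:
  assumes "Factorial_Ring.prime p" "odd p" "m > 0"
  shows "\<exists>z. cyc_sum m p = of_nat p * (1 - (1 - \<xi> ^ m) * z) + (1 - \<xi> ^ m) ^ (p - 1)"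
  using geometric_sum_uniformizer[OF assms(1,2) one_minus_indeterminate_power_nonzero[OF assms(3)]]
  by (simp add: cyc_sum_def power_mult)

lemma cyc_sum_cong_prime:
  assumes "Factorial_Ring.prime p" "odd p" "m > 0"
  shows "\<exists>c. cyc_sum m p = of_nat p + (1 - \<xi> ^ m) * c"
proof -
  obtain z where z: "cyc_sum m p = of_nat p * (1 - (1 - \<xi> ^ m) * z) + (1 - \<xi> ^ m) ^ (p - 1)"
    using cyc_sum_uniformizer[OF assms] by blast
  obtain r where r: "p - 1 = Suc r"
    using prime_gt_1_nat[OF assms(1)] by (metis Suc_diff_1 zero_less_diff)
  have "cyc_sum m p = of_nat p + (1 - \<xi> ^ m) * ((1 - \<xi> ^ m) ^ r - of_nat p * z)"
    unfolding z r by (simp add: algebra_simps)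
  then show ?thesis by blast
qed

text \<open>Write \<Psi> as \<open>p + \<pi> * c\<close>. From \<open>\<pi> * a = \<Psi> * b\<close>
  follows \<open>p * b = \<pi> * (a - c * b)\<close>. The prime \<open>p\<close> does not divide
  \<open>\<pi>\<close>, whose constant coefficient is 1, so it divides \<open>a - c * b\<close>;
  hence \<open>\<pi>\<close> divides \<open>b\<close> and can be cancelled.\<close>

lemma cyc_sum_dvd_cancel:
  assumes "Factorial_Ring.prime p" "odd p" "m > 0" "cyc_sum m p dvd (1 - \<xi> ^ m) * a"
  shows "cyc_sum m p dvd a"
proof -
  let ?\<pi> = "1 - \<xi> ^ m"
  obtain c where c: "cyc_sum m p = of_nat p + ?\<pi> * c"
    using cyc_sum_cong_prime[OF assms(1-3)] by blast
  obtain b where b: "?\<pi> * a = cyc_sum m p * b" using assms(4) by (rule dvdE)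
  have pb: "of_nat p * b = ?\<pi> * (a - c * b)" using b unfolding c by (simp add: algebra_simps)
  have "\<not> of_nat p dvd ?\<pi>"
  proof
    assume "of_nat p dvd ?\<pi>"
    then have "int p dvd poly.coeff ?\<pi> 0" unfolding of_nat_poly const_poly_dvd_iff by blast
    then show False using assms(1,3) by (simp add: coeff_indeterminate_power)
  qed
  then have "of_nat p dvd a - c * b"
    using prime_elem_of_nat_poly[OF assms(1)] pb by (metis dvd_triv_left prime_elem_dvd_mult_iff)
  then obtain d where d: "a - c * b = of_nat p * d" by (rule dvdE)
  have p0: "of_nat p \<noteq> (0 :: int poly)" using assms(1) by auto
  have "of_nat p * b = of_nat p * (?\<pi> * d)" using pb d by (simp add: mult.left_commute)
  then have "b = ?\<pi> * d" using p0 by (metis mult_left_cancel)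
  then have "?\<pi> * a = ?\<pi> * (cyc_sum m p * d)" using b by (simp add: mult.left_commute)
  then show ?thesis
    using one_minus_indeterminate_power_nonzero[OF assms(3)] by (metis mult_left_cancel dvd_triv_left)
qed

lemma fermat_prime_power_int:
  assumes "Factorial_Ring.prime p"
  shows "int p dvd a ^ (p ^ n) - a"
proof -
  have nat_case: "int p dvd int b ^ (p ^ n) - int b" for b
  proof (induction b)
    case (Suc b)
    have "int p dvd (int b + 1) ^ (p ^ n) - (int b ^ (p ^ n) + 1 ^ (p ^ n))"
      using prime_dvd_frobenius_add[OF assms, of "int b" 1 n] by simp
    from dvd_add[OF this Suc.IH] show ?case by (simp add: algebra_simps)
  qed (use prime_gt_0_nat[OF assms] in \<open>simp add: zero_power\<close>)
  have "[a ^ (p ^ n) = int (nat (a mod int p)) ^ (p ^ n)] (mod int p)"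
    using assms prime_gt_0_nat[OF assms] by (intro cong_pow) (simp add: cong_def)
  moreover have "[a = int (nat (a mod int p))] (mod int p)"
    using assms prime_gt_0_nat[OF assms] by (simp add: cong_def)
  ultimately show ?thesis
    using nat_case by (metis cong_iff_dvd_diff cong_sym cong_trans)
qed

text \<open>Additivity of the Frobenius power modulo \<open>p\<close> reduces the claim to
  constants, where it is Fermat's theorem, and to X, where \<open>X ^ q = X * X ^ (q - 1)\<close>
  with \<open>q = p ^ n\<close>.\<close>

lemma poly_frobenius_cong:
  fixes f :: "int poly"
  assumes "Factorial_Ring.prime p"
  shows "\<exists>a b. f ^ (p ^ n) - f = of_nat p * a + (1 - \<xi> ^ (p ^ n - 1)) * b"
proof (induction f)
  case 0
  show ?case using assms prime_gt_0_nat by (intro exI[of _ 0]) simp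
next
  case (pCons c f)
  let ?q = "p ^ n" and ?\<pi> = "1 - \<xi> ^ (p ^ n - 1)"
  have q: "?q > 0" using assms prime_gt_0_nat by simp
  obtain a b where ab: "f ^ ?q - f = of_nat p * a + ?\<pi> * b" using pCons.IH by blast
  obtain a1 where a1: "([:c:] + \<xi> * f) ^ ?q = ([:c:] ^ ?q + (\<xi> * f) ^ ?q) + of_nat p * a1"
    using prime_dvd_frobenius_add[OF assms, of "[:c:]" "\<xi> * f" n] by (rule dvd_diffE)
  obtain d where d: "c ^ ?q = c + int p * d"
    using fermat_prime_power_int[OF assms, of c n] by (rule dvd_diffE)
  have const: "[:c:] ^ ?q = [:c:] + of_nat p * [:d:]"
    by (simp add: poly_const_pow d of_nat_poly)
  have Xq: "\<xi> ^ ?q = \<xi> * \<xi> ^ (?q - 1)" 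
    using q power_Suc[of \<xi> "?q - 1"] by simp
  have "f ^ ?q = f + (of_nat p * a + ?\<pi> * b)" using ab by (simp add: algebra_simps)
  then have "(\<xi> * f) ^ ?q = \<xi> * \<xi> ^ (?q - 1) * (f + (of_nat p * a + ?\<pi> * b))"
    by (simp only: power_mult_distrib Xq)
  then have "([:c:] + \<xi> * f) ^ ?q - ([:c:] + \<xi> * f) =
      of_nat p * ([:d:] + \<xi> * \<xi> ^ (?q - 1) * a + a1) + ?\<pi> * (\<xi> * \<xi> ^ (?q - 1) * b - \<xi> * f)"
    unfolding a1 const by (simp only: algebra_simps)
  then show ?case unfolding pCons_conv_indeterminate[of c f] by blast
qed

text \<open>Since \<open>p\<close> is a multiple of \<open>1 - \<xi> ^ m\<close> modulo \<Psi>, the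
  preceding congruence needs only this one modulus. This supplies \<open>frob\<close> of
  \<open>multiplier_divisibility\<close>.\<close>

lemma cyc_sum_frobenius:
  assumes "Factorial_Ring.prime p" "odd p" "m > 0" "p ^ n = Suc m"
  shows "\<exists>w. cyc_sum m p dvd f ^ Suc m - f - (1 - \<xi> ^ m) * w"
proof -
  obtain c where c: "cyc_sum m p = of_nat p + (1 - \<xi> ^ m) * c"
    using cyc_sum_cong_prime[OF assms(1-3)] by blast
  obtain a b where ab: "f ^ Suc m - f = of_nat p * a + (1 - \<xi> ^ m) * b"
    using poly_frobenius_cong[OF assms(1), of f n] assms(4) by auto
  have "f ^ Suc m - f - (1 - \<xi> ^ m) * (b - c * a) = cyc_sum m p * a"
    unfolding ab c by (simp add: algebra_simps)
  then show ?thesis by (metis dvd_triv_left)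
qed

text \<open>It suffices that \<open>\<xi> ^ s - \<xi>\<close> is a multiple of
  \<open>1 - \<xi> ^ (m * k)\<close>; the rest is Horner's scheme.\<close>

lemma pcompose_indeterminate_power_cong:
  fixes f :: "int poly"
  assumes "s = m * k + 1"
  shows "1 - \<xi> ^ m dvd pcompose f (\<xi> ^ s) - f"
proof (induction f)
  case (pCons c f)
  have "1 - \<xi> ^ m dvd 1 - (\<xi> ^ m) ^ k" by (simp add: one_diff_power_eq)
  then have "1 - \<xi> ^ m dvd - (\<xi> * (1 - \<xi> ^ (m * k)))"
    unfolding power_mult by (metis dvd_minus_iff dvd_mult)
  then have 1: "1 - \<xi> ^ m dvd \<xi> ^ s - \<xi>" unfolding assms by (simp add: algebra_simps)
  have "pcompose (pCons c f) (\<xi> ^ s) = [:c:] + \<xi> ^ s * pcompose f (\<xi> ^ s)"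
    by (rule pcompose_pCons)
  then have "pcompose (pCons c f) (\<xi> ^ s) - pCons c f =
     \<xi> ^ s * (pcompose f (\<xi> ^ s) - f) + (\<xi> ^ s - \<xi>) * f"
    by (simp add: pCons_conv_indeterminate[of c f] algebra_simps del: pcompose_pCons)
  then show ?case using 1 pCons.IH by (metis dvd_add dvd_mult dvd_mult2)
qed simp

section \<open>Linear functionals and coefficients modulo \<Psi>\<close>

text \<open>The Z-linear functional on Z[X] that takes the value \<open>w j\<close> at
  \<open>X ^ j\<close>.\<close>

definition lincomb :: "(nat \<Rightarrow> int) \<Rightarrow> int poly \<Rightarrow> int" where
  "lincomb w f = (\<Sum>j\<le>Polynomial.degree f. poly.coeff f j * w j)"

lemma lincomb_eq:
  assumes "Polynomial.degree f \<le> N"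
  shows "lincomb w f = (\<Sum>j\<le>N. poly.coeff f j * w j)"
  unfolding lincomb_def using assms
  by (intro sum.mono_neutral_left) (auto simp: coeff_eq_0)

lemma lincomb_add: "lincomb w (f + g) = lincomb w f + lincomb w g"
proof -
  let ?N = "max (Polynomial.degree f) (Polynomial.degree g)"
  have "Polynomial.degree (f + g) \<le> ?N" by (rule degree_add_le_max)
  then show ?thesis
    by (simp add: lincomb_eq[of _ ?N] sum.distrib distrib_right)
qed

lemma lincomb_smult: "lincomb w (smult c f) = c * lincomb w f"
  by (subst lincomb_eq[of _ "Polynomial.degree f"])
     (simp_all add: degree_smult_le lincomb_def sum_distrib_left mult.assoc)

lemma lincomb_0 [simp]: "lincomb w 0 = 0"
  by (simp add: lincomb_def)

lemma lincomb_sum: "lincomb w (\<Sum>i\<in>A. f i) = (\<Sum>i\<in>A. lincomb w (f i))"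
  by (induction A rule: infinite_finite_induct) (simp_all add: lincomb_add)

lemma lincomb_indeterminate_power: "lincomb w (\<xi> ^ k) = w k"
  by (subst lincomb_eq[of _ k])
     (auto simp: degree_power_eq indeterminate_def[symmetric] coeff_indeterminate_power
       intro!: degree_le)

lemma lincomb_indeterminate_mult: "lincomb w (\<xi> * f) = lincomb (\<lambda>j. w (Suc j)) f"
  by (subst lincomb_eq[of _ "Suc (Polynomial.degree f)"])
     (simp_all add: indeterminate_def degree_pCons_le sum.atMost_Suc_shift lincomb_def del: sum.atMost_Suc)

text \<open>Multiplication by X shifts \<open>w\<close>, and the hypothesis is invariant under
  shifts, so the value at \<Psi> itself decides.\<close>

lemma lincomb_cyc_sum_mult:
  assumes "\<And>j. (\<Sum>i<p. w (j + m * i)) = 0"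
  shows "lincomb w (cyc_sum m p * f) = 0"
  using assms
proof (induction f arbitrary: w)
  case (pCons c f)
  have "lincomb w (cyc_sum m p) = (\<Sum>i<p. w (0 + m * i))"
    by (simp add: cyc_sum_def lincomb_sum lincomb_indeterminate_power)
  also have "\<dots> = 0" by (rule pCons.prems)
  finally have 1: "lincomb w (cyc_sum m p) = 0" .
  have "lincomb (\<lambda>j. w (Suc j)) (cyc_sum m p * f) = 0"
    by (rule pCons.IH) (use pCons.prems[of "Suc _"] in simp)
  moreover have "cyc_sum m p * pCons c f = smult c (cyc_sum m p) + \<xi> * (cyc_sum m p * f)"
    by (simp add: indeterminate_def)
  ultimately show ?case using 1 by (simp add: lincomb_add lincomb_smult lincomb_indeterminate_mult)
qed simp

text \<open>The class has at most \<open>p\<close> members, so injectivity suffices. It consists of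
  the exponents of one coset of N_1, or of N_2 when \<open>m\<close> and \<open>p\<close> are
  exchanged.\<close>

lemma bij_betw_residue_class:
  fixes p m j :: nat
  assumes "p > 0" "m > 0"
  shows "bij_betw (\<lambda>i. (j + m * i) mod (m * p)) {..<p} {k. k < m * p \<and> k mod m = j mod m}"
proof -
  let ?f = "\<lambda>i. (j + m * i) mod (m * p)" and ?C = "{k. k < m * p \<and> k mod m = j mod m}"
  have inj: "inj_on ?f {..<p}"
  proof (rule inj_onI)
    fix i i' assume "i \<in> {..<p}" "i' \<in> {..<p}" "?f i = ?f i'"
    then have "[j + m * i = j + m * i'] (mod m * p)" by (simp add: cong_def)
    then have "(m * i) mod (m * p) = (m * i') mod (m * p)"
      unfolding cong_add_lcancel_nat by (simp add: cong_def)
    then have "i mod p = i' mod p" using assms by (simp add: mult_mod_right [symmetric])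
    then show "i = i'" using \<open>i \<in> {..<p}\<close> \<open>i' \<in> {..<p}\<close> by simp
  qed
  have sub: "?f ` {..<p} \<subseteq> ?C" using assms by (auto simp: mod_mod_cancel)
  have "?C \<subseteq> (\<lambda>i. j mod m + m * i) ` {..<p}"
  proof
    fix k assume "k \<in> ?C"
    then have "k = j mod m + m * (k div m)" "k div m < p"
      by (auto simp: less_mult_imp_div_less mult.commute) (metis mod_mult_div_eq)
    then show "k \<in> (\<lambda>i. j mod m + m * i) ` {..<p}" by blast
  qed
  then have "card ?C \<le> p" using surj_card_le[OF finite_lessThan[of p]] by simp
  moreover have "card (?f ` {..<p}) = p" using inj by (simp add: card_image)
  moreover have "finite ?C" by simp
  ultimately have "?f ` {..<p} = ?C" using sub card_seteq[of ?C "?f ` {..<p}"] by simp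
  with inj show ?thesis by (simp add: bij_betw_def)
qed

lemma card_residue_class_hits:
  fixes p m j k :: nat
  assumes "p > 0" "m > 0" "k < m * p"
  shows "card {i. i < p \<and> (j + m * i) mod (m * p) = k} = of_bool (j mod m = k mod m)"
proof -
  note b = bij_betw_residue_class[OF assms(1,2), of j]
  show ?thesis
  proof (cases "k mod m = j mod m")
    case True
    then have "k \<in> (\<lambda>i. (j + m * i) mod (m * p)) ` {..<p}"
      using b assms(3) by (simp add: bij_betw_def)
    then obtain i where i: "i < p" "k = (j + m * i) mod (m * p)" by blast
    then have "{i'. i' < p \<and> (j + m * i') mod (m * p) = k} = {i}"
      using b by (auto simp: bij_betw_def inj_on_def)
    then show ?thesis using True by simp
  next
    case False
    then have "{i. i < p \<and> (j + m * i) mod (m * p) = k} = {}"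
      by (auto simp: mod_mod_cancel)
    then show ?thesis using False by (simp del: Collect_empty_eq)
  qed
qed

text \<open>Apply the functional that counts exponents congruent to \<open>k\<close> positively and
  to \<open>k'\<close> negatively modulo \<open>m * p\<close>. A coset of N_1 contains both or
  neither, so multiples of \<Psi> are sent to 0, and \<open>c k - c k'\<close> remains on the
  left.\<close>

lemma coeff_cong_modulo_cyc_sum:
  fixes c :: "nat \<Rightarrow> int"
  assumes "p > 0" "m > 0"
    and dvd: "cyc_sum m p dvd (\<Sum>k<m * p. smult (c k) (\<xi> ^ k)) - smult Q f"
    and k: "k < m * p" "k' < m * p" "k mod m = k' mod m"
  shows "Q dvd c k - c k'"
proof -
  define w :: "nat \<Rightarrow> int"
    where "w = (\<lambda>j. of_bool (j mod (m * p) = k) - of_bool (j mod (m * p) = k'))"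
  have hits: "(\<Sum>i<p. of_bool ((j + m * i) mod (m * p) = l)) = (of_bool (j mod m = l mod m) :: int)"
    if "l < m * p" for j l
  proof -
    have "(\<Sum>i<p. of_bool ((j + m * i) mod (m * p) = l)) =
      int (card {i. i < p \<and> (j + m * i) mod (m * p) = l})"
      by (simp add: of_bool_def sum.If_cases Int_def conj_commute)
    then show ?thesis using card_residue_class_hits[OF assms(1,2) that, of j] by simp
  qed
  have "(\<Sum>i<p. w (j + m * i)) = 0" for j
    using hits[OF k(1), of j] hits[OF k(2), of j] k(3) by (simp add: w_def sum_subtractf)
  note zero = lincomb_cyc_sum_mult[OF this]
  obtain B where B: "(\<Sum>k<m * p. smult (c k) (\<xi> ^ k)) = smult Q f + cyc_sum m p * B"
    using dvd by (rule dvd_diffE)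
  have "lincomb w (\<Sum>k<m * p. smult (c k) (\<xi> ^ k)) = (\<Sum>j<m * p. c j * w j)"
    by (simp add: lincomb_sum lincomb_smult lincomb_indeterminate_power)
  also have "\<dots> = (\<Sum>j<m * p. c j * of_bool (j = k)) - (\<Sum>j<m * p. c j * of_bool (j = k'))"
    unfolding sum_subtractf [symmetric] by (intro sum.cong) (auto simp: w_def)
  also have "\<dots> = c k - c k'" using k by (simp add: of_bool_def if_distrib cong: if_cong)
  finally have "c k - c k' = Q * lincomb w f"
    unfolding B by (simp add: lincomb_add lincomb_smult zero)
  then show ?thesis by simp
qed

section \<open>Difference sets in cyclic groups\<close>

lemma card_affine_residue:
  fixes p s j r :: nat
  assumes "p > 0" "coprime s p" "r < p"
  shows "card {i. i < p \<and> (s * i + j) mod p = r} = 1"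
proof -
  let ?f = "\<lambda>i. (s * i + j) mod p"
  have inj: "inj_on ?f {..<p}"
  proof (rule inj_onI)
    fix i i' assume i: "i \<in> {..<p}" "i' \<in> {..<p}" "?f i = ?f i'"
    then have "[s * i = s * i'] (mod p)"
      by (simp add: cong_def[symmetric] cong_add_rcancel_nat)
    then have "[i = i'] (mod p)" using assms(2) by (simp add: cong_mult_lcancel_nat)
    then show "i = i'" using i by (simp add: cong_def)
  qed
  have "?f ` {..<p} = {..<p}"
    using assms(1) by (intro endo_inj_surj inj) auto
  then have "r \<in> ?f ` {..<p}" using assms(3) by simp
  then obtain i where i: "i < p" "?f i = r" by auto
  then have "{i'. i' < p \<and> ?f i' = r} = {i}" using inj by (auto simp: inj_on_def)
  then show ?thesis by simp
qed

lemma card_collect_fibres: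
  assumes "finite A" "f ` A \<subseteq> B" "finite B"
  shows "(\<Sum>b\<in>B. card {a \<in> A. f a = b}) = card A"
  using sum.group[OF assms(1,3,2), of "\<lambda>_. 1 :: nat"] by simp

lemma sum_of_bool_card:
  assumes "finite A"
  shows "(\<Sum>a\<in>A. of_bool (P a)) = int (card {a \<in> A. P a})"
  using assms by (simp add: of_bool_def sum.If_cases Int_def)

lemma cyc_sum_dvd_one_minus: "cyc_sum m p dvd 1 - \<xi> ^ (m * p * k)"
proof -
  have "1 - \<xi> ^ (m * p) dvd 1 - \<xi> ^ (m * p * k)"
    unfolding power_mult[of _ "m * p" k] by (simp add: one_diff_power_eq)
  then show ?thesis by (metis cyc_sum_mult dvd_trans dvd_triv_left)
qed

lemma cyc_sum_dvd_geometric: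
  assumes "m > 0"
  shows "cyc_sum m p dvd (\<Sum>k<m * p. \<xi> ^ k)"
proof -
  have "cyc_sum 1 (m * p) * (1 - \<xi> ^ 1) = cyc_sum m p * (1 - \<xi> ^ m)"
    unfolding cyc_sum_mult by simp
  also have "1 - \<xi> ^ m = cyc_sum 1 m * (1 - \<xi> ^ 1)" unfolding cyc_sum_mult by simp
  finally have "cyc_sum 1 (m * p) * (1 - \<xi> ^ 1) = (cyc_sum m p * cyc_sum 1 m) * (1 - \<xi> ^ 1)"
    by (simp only: mult.assoc)
  then have "cyc_sum 1 (m * p) = cyc_sum m p * cyc_sum 1 m"
    using one_minus_indeterminate_power_nonzero[of 1] by (metis mult_right_cancel zero_less_one)
  then show ?thesis by (simp add: cyc_sum_def)
qed

lemma cyc_sum_conv_multiples: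
  assumes "m > 0"
  shows "cyc_sum m p = (\<Sum>k<m * p. smult (of_bool (m dvd k)) (\<xi> ^ k))"
proof -
  have img: "(\<lambda>i. m * i) ` {..<p} = {k. k < m * p \<and> m dvd k}"
    using assms by (auto simp: dvd_def)
  have "cyc_sum m p = (\<Sum>k\<in>(\<lambda>i. m * i) ` {..<p}. \<xi> ^ k)"
    unfolding cyc_sum_def using assms by (subst sum.reindex) (auto simp: inj_on_def)
  also have "\<dots> = (\<Sum>k<m * p. smult (of_bool (m dvd k)) (\<xi> ^ k))"
    unfolding img by (intro sum.mono_neutral_cong_left) auto
  finally show ?thesis .
qed

lemma pcompose_indeterminate_power: "pcompose (\<xi> ^ a) f = f ^ a"
proof (induction a)
  case (Suc a)
  have "pcompose \<xi> f = f" by (simp add: indeterminate_def pcompose_pCons)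
  with Suc show ?case by (simp add: pcompose_mult)
qed (simp add: pcompose_1)

text \<open>Multiplied by \<open>1 - \<xi> ^ (m * s)\<close>, the substituted sum becomes
  \<open>1 - \<xi> ^ (m * p * s)\<close>, a multiple of \<Psi>. An inverse \<open>s'\<close> of
  \<open>s\<close> modulo \<open>p\<close> turns that factor into \<open>1 - \<xi> ^ m\<close>
  modulo \<Psi>, which can be cancelled.\<close>

lemma cyc_sum_dvd_pcompose:
  assumes "Factorial_Ring.prime p" "odd p" "m > 0" "coprime s p"
  shows "cyc_sum m p dvd pcompose (cyc_sum m p) (\<xi> ^ s)"
proof -
  let ?F = "pcompose (cyc_sum m p) (\<xi> ^ s)"
  obtain s' where s': "[s * s' = 1] (mod p)" 
    using assms(4) cong_solve_coprime_nat[of s p] by (auto simp del: One_nat_def simp flip: One_nat_def)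
  then have "s * s' mod p = 1"
    using prime_gt_1_nat[OF assms(1)] by (simp add: cong_def)
  then obtain k where k: "s * s' = 1 + p * k"
    using mod_mult_div_eq[of "s * s'" p] by metis
  have "?F * (1 - \<xi> ^ (m * s)) = pcompose (cyc_sum m p * (1 - \<xi> ^ m)) (\<xi> ^ s)"
    by (simp add: pcompose_mult pcompose_diff pcompose_1 pcompose_indeterminate_power
        power_mult [symmetric] mult.commute)
  also have "\<dots> = 1 - \<xi> ^ (m * p * s)"
    unfolding cyc_sum_mult
    by (simp add: pcompose_diff pcompose_1 pcompose_indeterminate_power power_mult [symmetric]
        mult.commute)
  finally have "cyc_sum m p dvd ?F * (1 - \<xi> ^ (m * s))" using cyc_sum_dvd_one_minus by simp
  moreover have "1 - \<xi> ^ (m * s) dvd 1 - \<xi> ^ (m * s * s')"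
    unfolding power_mult[of _ "m * s" s'] by (simp add: one_diff_power_eq)
  ultimately have 1: "cyc_sum m p dvd ?F * (1 - \<xi> ^ (m * s * s'))"
    by (meson dvd_trans mult_dvd_mono dvd_refl)
  have "m * s * s' = m + m * p * k" using k by (simp add: algebra_simps)
  then have "\<xi> ^ (m * s * s') = \<xi> ^ m * \<xi> ^ (m * p * k)" by (simp only: power_add)
  then have "(1 - \<xi> ^ m) * ?F = ?F * (1 - \<xi> ^ (m * s * s')) - (1 - \<xi> ^ (m * p * k)) * (\<xi> ^ m * ?F)"
    by (simp only:) (simp add: algebra_simps)
  then have "cyc_sum m p dvd (1 - \<xi> ^ m) * ?F"
    using 1 cyc_sum_dvd_one_minus[of m p k] by (metis dvd_diff dvd_mult2)
  then show ?thesis by (rule cyc_sum_dvd_cancel[OF assms(1-3)])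
qed

text \<open>For integers \<open>d ^ 2 - d\<close> is nonnegative, with equality only at 0 and 1;
  here these terms add up to 0.\<close>

lemma int_01_of_sum_squares:
  fixes d :: "'i \<Rightarrow> int"
  assumes "finite A" "sum d A = 1" "(\<Sum>i\<in>A. d i ^ 2) = 1"
  shows "\<exists>c\<in>A. \<forall>i\<in>A. d i = of_bool (i = c)"
proof -
  have nonneg: "d i ^ 2 - d i \<ge> 0" for i
  proof -
    have "d i ^ 2 - d i = d i * (d i - 1)" by (simp add: power2_eq_square algebra_simps)
    then show ?thesis by (cases "d i \<ge> 1") (simp_all add: mult_nonpos_nonpos)
  qed
  have "(\<Sum>i\<in>A. d i ^ 2 - d i) = 0" using assms by (simp add: sum_subtractf)
  then have "\<forall>i\<in>A. d i ^ 2 - d i = 0"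
    using sum_nonneg_eq_0_iff[OF assms(1), of "\<lambda>i. d i ^ 2 - d i"] nonneg by blast
  then have d01: "d i = of_bool (d i = 1)" if "i \<in> A" for i
    using that by (auto simp: power2_eq_square)
  have "sum d A = (\<Sum>i\<in>A. of_bool (d i = 1))" using d01 by (intro sum.cong) auto
  then have "int (card {i \<in> A. d i = 1}) = 1"
    using assms(2) sum_of_bool_card[OF assms(1), of "\<lambda>i. d i = 1"] by linarith
  then obtain c where "{i \<in> A. d i = 1} = {c}" by (auto simp: card_1_singleton_iff)
  then have "c \<in> A" "\<forall>i\<in>A. d i = 1 \<longleftrightarrow> i = c" by auto
  then show ?thesis using d01 by (intro bexI[of _ c]) auto
qed

text \<open>A term that reaches \<open>q\<close> exhausts the sum. If there is none, all terms are
  reduced residues modulo \<open>q\<close> and hence equal.\<close>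

lemma congruent_nonneg_sum_eq_modulus:
  fixes e :: "'i \<Rightarrow> int"
  assumes "finite A" "\<And>i. i \<in> A \<Longrightarrow> e i \<ge> 0" "sum e A = q" "q > 0"
    and "\<And>i j. i \<in> A \<Longrightarrow> j \<in> A \<Longrightarrow> q dvd e i - e j"
  shows "(\<exists>i\<in>A. e i = q) \<or> (\<forall>i\<in>A. int (card A) * e i = q)"
proof (cases "\<exists>i\<in>A. e i \<ge> q")
  case True
  then obtain i where i: "i \<in> A" "e i \<ge> q" by blast
  have "e i \<le> sum e A" using assms(1,2) i(1) by (intro member_le_sum) auto
  then show ?thesis using i assms(3) by auto
next
  case False
  have eq: "e i = e j" if "i \<in> A" "j \<in> A" for i j
  proof -
    have "e i mod q = e j mod q" using assms(5)[OF that] by (simp add: mod_eq_dvd_iff)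
    moreover have "e i < q" "e j < q" using False that by auto
    ultimately show ?thesis using assms(2) that by simp
  qed
  have "int (card A) * e i = q" if "i \<in> A" for i
  proof -
    have "sum e A = (\<Sum>j\<in>A. e i)" using that by (intro sum.cong) (auto intro: eq)
    then show ?thesis using assms(3) by simp
  qed
  then show ?thesis by blast
qed

lemma smult_sum_right: "smult c (\<Sum>i\<in>A. f i) = (\<Sum>i\<in>A. smult c (f i))"
  by (induction A rule: infinite_finite_induct) (simp_all add: smult_add_right)

lemma sum_of_bool_eq_mult:
  fixes f :: "'i \<Rightarrow> int"
  assumes "finite A" "c \<in> A"
  shows "(\<Sum>u\<in>A. of_bool (u = c) * f u) = f c"
proof -
  have "(\<Sum>u\<in>A. of_bool (u = c) * f u) = (\<Sum>u\<in>A. if u = c then f u else 0)"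
    by (intro sum.cong) auto
  then show ?thesis using assms by simp
qed

text \<open>The difference set written in exponents of a generator of G: N_1 becomes the multiples
  of \<open>m\<close> and N_2 those of \<open>p\<close>. Adding \<open>m * p\<close> before
  subtracting avoids truncation.\<close>

locale cyclic_difference_set =
  fixes p n m :: nat and S :: "nat set"
  assumes prime: "Factorial_Ring.prime p" and odd: "odd p"
    and n: "n \<ge> 1" and m: "p ^ n = Suc m"
    and S: "S \<subseteq> {..<m * p}" "card S = m"
    and count: "\<And>k. 0 < k \<Longrightarrow> k < m * p \<Longrightarrow>
      card {z \<in> S \<times> S. (fst z + (m * p - snd z)) mod (m * p) = k} =
        (if m dvd k then 0 else if p dvd k then p ^ (n - 1) - 1 else p ^ (n - 1))"
begin

section \<open>The ring T and the sum over N_2\<close>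

abbreviation "\<Psi> \<equiv> cyc_sum m p"
abbreviation "N\<^sub>2 \<equiv> cyc_sum p m"

text \<open>Equality of images in T, where exponents of X matter only modulo
  \<open>m * p\<close>.\<close>

definition eqv :: "int poly \<Rightarrow> int poly \<Rightarrow> bool" (infix "\<doteq>" 50) where
  "f \<doteq> g \<longleftrightarrow> \<Psi> dvd f - g"

lemma eqv_refl [simp]: "f \<doteq> f" by (simp add: eqv_def)
lemma eqv_sym: "f \<doteq> g \<Longrightarrow> g \<doteq> f" unfolding eqv_def by (metis dvd_minus_iff minus_diff_eq)
lemma eqv_trans [trans]: "f \<doteq> g \<Longrightarrow> g \<doteq> h \<Longrightarrow> f \<doteq> h"
  unfolding eqv_def by (metis dvd_add diff_add_cancel add_diff_eq)
lemma eqv_add: "f \<doteq> g \<Longrightarrow> f' \<doteq> g' \<Longrightarrow> f + f' \<doteq> g + g'"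
  unfolding eqv_def by (metis add_diff_add dvd_add)
lemma eqv_diff: "f \<doteq> g \<Longrightarrow> f' \<doteq> g' \<Longrightarrow> f - f' \<doteq> g - g'"
  unfolding eqv_def by (metis dvd_diff diff_diff_eq2 add_diff_eq diff_add_eq)
lemma eqv_mult: "f \<doteq> g \<Longrightarrow> f' \<doteq> g' \<Longrightarrow> f * f' \<doteq> g * g'"
  unfolding eqv_def by (metis mult_diff_mult dvd_add dvd_mult dvd_mult2)
lemma eqv_sum: "(\<And>i. i \<in> A \<Longrightarrow> f i \<doteq> g i) \<Longrightarrow> sum f A \<doteq> sum g A"
  unfolding eqv_def sum_subtractf [symmetric] by (rule dvd_sum)

lemma m_ge: "m \<ge> 2"
proof -
  have "p ^ 1 \<le> p ^ n" using n prime_gt_0_nat[OF prime] by (intro power_increasing) auto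
  moreover have "p \<ge> 3" using prime_gt_1_nat[OF prime] odd by (cases "p = 2") auto
  ultimately show ?thesis using m by simp
qed

lemma p_pos: "p > 0" using prime prime_gt_0_nat by blast

lemma v_pos: "m * p > 0" using m_ge p_pos by simp

lemma finite_S: "finite S" using S(1) finite_subset by blast

lemma p_power: "p * p ^ (n - 1) = Suc m" using m n by (metis power_eq_if not_one_le_zero)

lemma coprime_m_p: "coprime m p"
proof -
  have "coprime (Suc m) m" by simp
  then show ?thesis unfolding p_power [symmetric] by (simp add: coprime_commute)
qed

lemma power_eqv: "\<xi> ^ j \<doteq> \<xi> ^ (j mod (m * p))"
proof -
  have "\<xi> ^ (j mod (m * p)) - \<xi> ^ j = \<xi> ^ (j mod (m * p)) * (1 - \<xi> ^ (m * p * (j div (m * p))))"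
    by (simp add: right_diff_distrib power_add [symmetric])
  then show ?thesis
    using cyc_sum_dvd_one_minus[of m p "j div (m * p)"] by (metis dvd_mult eqv_def eqv_sym)
qed

lemma sum_power_eqv:
  assumes "finite A"
  shows "(\<Sum>a\<in>A. \<xi> ^ f a) \<doteq>
    (\<Sum>k<m * p. smult (int (card {a \<in> A. f a mod (m * p) = k})) (\<xi> ^ k))"
proof -
  have "(\<Sum>a\<in>A. \<xi> ^ f a) \<doteq> (\<Sum>a\<in>A. \<xi> ^ (f a mod (m * p)))" by (intro eqv_sum power_eqv)
  also have "(\<Sum>a\<in>A. \<xi> ^ (f a mod (m * p))) =
    (\<Sum>k<m * p. \<Sum>a\<in>{a \<in> A. f a mod (m * p) = k}. \<xi> ^ (f a mod (m * p)))"
    using assms v_pos by (intro sum.group [symmetric]) auto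
  also have "\<dots> = (\<Sum>k<m * p. smult (int (card {a \<in> A. f a mod (m * p) = k})) (\<xi> ^ k))"
    by (intro sum.cong) (simp_all add: of_nat_poly)
  finally show ?thesis .
qed

lemma N2_power_absorb: "\<xi> ^ (p * j) * N\<^sub>2 \<doteq> N\<^sub>2"
proof (induction j)
  case (Suc j)
  have "N\<^sub>2 * (1 - \<xi> ^ p) \<doteq> 0"
    unfolding cyc_sum_mult eqv_def using cyc_sum_dvd_one_minus[of m p 1] by (simp add: mult.commute)
  from eqv_diff[OF eqv_refl[of "N\<^sub>2"] this]
  have 1: "\<xi> ^ p * N\<^sub>2 \<doteq> N\<^sub>2" by (simp add: algebra_simps)
  have "\<xi> ^ (p * Suc j) * N\<^sub>2 = \<xi> ^ (p * j) * (\<xi> ^ p * N\<^sub>2)"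
    by (simp add: power_add mult.commute mult.left_commute)
  also have "\<dots> \<doteq> \<xi> ^ (p * j) * N\<^sub>2" by (intro eqv_mult 1) simp
  also note Suc.IH
  finally show ?case .
qed simp

lemma N2_square: "N\<^sub>2 * N\<^sub>2 \<doteq> of_nat m * N\<^sub>2"
proof -
  have "N\<^sub>2 * N\<^sub>2 = (\<Sum>j<m. \<xi> ^ (p * j) * N\<^sub>2)"
    by (subst (1) cyc_sum_def) (simp add: sum_distrib_right)
  also have "\<dots> \<doteq> (\<Sum>j<m. N\<^sub>2)" by (intro eqv_sum N2_power_absorb)
  finally show ?thesis by simp
qed

text \<open>\<open>m\<close> times the idempotent that removes the trivial character of \<open>K\<^sup>*\<close>.\<close>

definition \<epsilon> :: "int poly" where "\<epsilon> = of_nat m - N\<^sub>2"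

lemma eps_N2: "\<epsilon> * N\<^sub>2 \<doteq> 0"
  using eqv_diff[OF eqv_refl[of "of_nat m * N\<^sub>2"] N2_square]
  by (simp add: \<epsilon>_def left_diff_distrib)

lemma eps_square: "\<epsilon> * \<epsilon> \<doteq> of_nat m * \<epsilon>"
  using eqv_diff[OF eqv_refl[of "\<epsilon> * of_nat m"] eps_N2]
  by (simp add: \<epsilon>_def algebra_simps)

lemma eqv_power: "f \<doteq> g \<Longrightarrow> f ^ k \<doteq> g ^ k"
  unfolding eqv_def by (rule dvd_power_diff)

section \<open>The images of D and its inverse in T, and their correlations\<close>

definition \<theta> :: "int poly" where "\<theta> = (\<Sum>a\<in>S. \<xi> ^ a)"
definition \<theta>' :: "int poly" where "\<theta>' = (\<Sum>b\<in>S. \<xi> ^ (m * p - b))"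

text \<open>A representative of \<open>s * fst z - snd z\<close> modulo \<open>m * p\<close>; the subtraction never truncates, because \<open>S \<subseteq> {..<m * p}\<close>.\<close>

definition dif :: "nat \<Rightarrow> nat \<times> nat \<Rightarrow> nat" where
  "dif s z = s * fst z + (m * p - snd z)"

text \<open>The coefficient of \<open>X ^ k\<close> in
  \<open>pcompose \<theta> (\<xi> ^ s) * \<theta>'\<close> once exponents are reduced modulo
  \<open>m * p\<close>.\<close>

definition corr :: "nat \<Rightarrow> nat \<Rightarrow> nat" where
  "corr s k = card {z \<in> S \<times> S. dif s z mod (m * p) = k}"

text \<open>The corresponding coefficient after multiplication by the sum over N_2: the total of
  \<open>corr s\<close> over the coset of \<open>k\<close>.\<close>

definition corr_p :: "nat \<Rightarrow> nat \<Rightarrow> nat" where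
  "corr_p s k = card {z \<in> S \<times> S. dif s z mod p = k mod p}"

lemma dif_mod_iff:
  assumes "z \<in> S \<times> S" "d dvd m * p"
  shows "dif s z mod d = k mod d \<longleftrightarrow> (s * fst z) mod d = (snd z + k) mod d"
proof -
  have z: "snd z \<le> m * p" using assms(1) S(1) by auto
  have "[dif s z = k] (mod d) \<longleftrightarrow> [dif s z + snd z = k + snd z] (mod d)"
    by (simp add: cong_add_rcancel_nat)
  also have "dif s z + snd z = s * fst z + m * p" using z by (simp add: dif_def)
  also have "[s * fst z + m * p = k + snd z] (mod d) \<longleftrightarrow> [s * fst z = k + snd z] (mod d)"
    using assms(2) by (auto simp: cong_def elim!: dvdE)
  finally show ?thesis by (simp add: cong_def add.commute)
qed

lemma corr_1_0: "corr 1 0 = m"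
proof -
  have "dif 1 z mod (m * p) = 0 \<longleftrightarrow> fst z = snd z" if z: "z \<in> S \<times> S" for z
  proof -
    have "fst z < m * p" "snd z < m * p" using S(1) z by auto
    then show ?thesis using dif_mod_iff[OF z dvd_refl, of 1 0] by simp
  qed
  then have "{z \<in> S \<times> S. dif 1 z mod (m * p) = 0} = {z \<in> S \<times> S. fst z = snd z}"
    by (intro Collect_cong) metis
  also have "\<dots> = (\<lambda>a. (a, a)) ` S" by (force simp: image_iff)
  finally have "{z \<in> S \<times> S. dif 1 z mod (m * p) = 0} = (\<lambda>a. (a, a)) ` S" .
  then show ?thesis using S(2) by (simp add: corr_def card_image inj_on_def)
qed

lemma corr_1:
  assumes "0 < k" "k < m * p"
  shows "corr 1 k = (if m dvd k then 0 else if p dvd k then p ^ (n - 1) - 1 else p ^ (n - 1))"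
  using count[OF assms] by (simp add: corr_def dif_def)

lemma not_both_dvd:
  assumes "0 < k" "k < m * p" "m dvd k" "p dvd k"
  shows False
proof -
  have "m * p dvd k" using assms coprime_m_p by (simp add: divides_mult)
  then show False using assms by (simp add: nat_dvd_not_less)
qed

lemma pcompose_theta: "pcompose \<theta> (\<xi> ^ s) = (\<Sum>a\<in>S. \<xi> ^ (s * a))"
  by (simp add: \<theta>_def pcompose_sum pcompose_indeterminate_power power_mult)

lemma theta_product: "pcompose \<theta> (\<xi> ^ s) * \<theta>' = (\<Sum>z\<in>S \<times> S. \<xi> ^ dif s z)"
  by (simp add: pcompose_theta \<theta>'_def sum_product sum.cartesian_product dif_def power_add case_prod_beta)

lemma theta_product_eqv:
  "pcompose \<theta> (\<xi> ^ s) * \<theta>' \<doteq> (\<Sum>k<m * p. smult (int (corr s k)) (\<xi> ^ k))"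
  unfolding theta_product corr_def by (rule sum_power_eqv) (simp add: finite_S)

lemma N2_conv_multiples: "N\<^sub>2 = (\<Sum>k<m * p. smult (of_bool (p dvd k)) (\<xi> ^ k))"
  using cyc_sum_conv_multiples[OF p_pos, of m] by (simp add: mult.commute)

text \<open>The parameters give \<open>corr 1 k\<close> as a combination of the indicators of 0, G,
  N_1 and N_2; at 0 it reads \<open>p ^ n + Q - Q - 1 = m\<close> with
  \<open>Q = p ^ (n - 1)\<close>. The sums over G and N_1 vanish in T.\<close>

lemma theta_theta'_eqv: "\<theta> * \<theta>' \<doteq> of_nat (p ^ n) - N\<^sub>2"
proof -
  let ?Q = "int (p ^ (n - 1))"
  have x1: "pcompose \<theta> (\<xi> ^ 1) = \<theta>"
    unfolding pcompose_theta by (simp add: \<theta>_def)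
  have Psi: "\<Psi> = (\<Sum>k<m * p. smult (of_bool (m dvd k)) (\<xi> ^ k))"
    using m_ge by (intro cyc_sum_conv_multiples) simp
  have coeff: "int (corr 1 k) =
      int (p ^ n) * of_bool (k = 0) + ?Q - ?Q * of_bool (m dvd k) - of_bool (p dvd k)"
    if "k < m * p" for k
  proof (cases "k = 0")
    case True
    then show ?thesis using corr_1_0 m by simp
  next
    case False
    have "p ^ (n - 1) \<ge> 1" using p_pos by (simp add: Suc_leI)
    then show ?thesis
      using False corr_1[of k] not_both_dvd[of k] that by (auto simp: of_nat_diff)
  qed
  have "\<theta> * \<theta>' \<doteq> (\<Sum>k<m * p. smult (int (corr 1 k)) (\<xi> ^ k))"
    using theta_product_eqv[of 1] unfolding x1 .
  also have "\<dots> = (\<Sum>k<m * p. smult (int (p ^ n) * of_bool (k = 0)) (\<xi> ^ k)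
      + smult ?Q (\<xi> ^ k) - smult ?Q (smult (of_bool (m dvd k)) (\<xi> ^ k))
      - smult (of_bool (p dvd k)) (\<xi> ^ k))"
    by (intro sum.cong) (simp_all only: coeff lessThan_iff smult_add_left smult_diff_left smult_smult)
  also have "\<dots> = (\<Sum>k<m * p. smult (int (p ^ n) * of_bool (k = 0)) (\<xi> ^ k))
      + smult ?Q (\<Sum>k<m * p. \<xi> ^ k) - smult ?Q \<Psi> - N\<^sub>2"
    unfolding Psi N2_conv_multiples smult_sum_right sum.distrib sum_subtractf ..
  also have "(\<Sum>k<m * p. smult (int (p ^ n) * of_bool (k = 0)) (\<xi> ^ k)) = of_nat (p ^ n)"
  proof -
    have "(\<Sum>k<m * p. smult (int (p ^ n) * of_bool (k = 0)) (\<xi> ^ k)) =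
      (\<Sum>k\<in>{0}. smult (int (p ^ n)) (\<xi> ^ k))"
      using v_pos by (intro sum.mono_neutral_cong_right) auto
    then show ?thesis by (simp add: of_nat_poly)
  qed
  also have "of_nat (p ^ n) + smult ?Q (\<Sum>k<m * p. \<xi> ^ k) - smult ?Q \<Psi> - N\<^sub>2 \<doteq>
      of_nat (p ^ n) - N\<^sub>2"
    using cyc_sum_dvd_geometric[of m p] m_ge unfolding eqv_def
    by (simp add: algebra_simps dvd_diff dvd_smult)
  finally show ?thesis .
qed

lemma p_power_poly: "(of_nat (p ^ n) :: int poly) = of_nat m + 1"
  by (simp add: m del: of_nat_power)

lemma theta_theta'_eps: "\<theta> * \<theta>' * \<epsilon> \<doteq> of_nat (p ^ n) * \<epsilon>"
proof -
  have "\<theta> * \<theta>' * \<epsilon> \<doteq> (of_nat (p ^ n) - N\<^sub>2) * \<epsilon>" by (intro eqv_mult theta_theta'_eqv eqv_refl)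
  also have "\<dots> = of_nat (p ^ n) * \<epsilon> - \<epsilon> * N\<^sub>2" by (simp add: algebra_simps)
  also have "\<dots> \<doteq> of_nat (p ^ n) * \<epsilon> - 0" by (intro eqv_diff eps_N2 eqv_refl)
  finally show ?thesis by simp
qed

text \<open>After multiplication by \<open>\<epsilon>\<close> the product
  \<open>\<theta> * \<theta>'\<close> is \<open>p ^ n\<close>, which is \<open>\<pi> ^ M\<close> up
  to a unit. So \<open>multiplier_divisibility\<close> carries the divisibility over to the
  substituted product.\<close>

lemma multiplier_product_divisible:
  assumes s: "s = m * c + 1" "coprime s p"
  shows "\<exists>w. (1 + N\<^sub>2) * (pcompose \<theta> (\<xi> ^ s) * \<theta>') \<doteq> of_nat (p ^ n) * w"
proof -
  have m0: "m > 0" using m_ge by simp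
  define \<pi> where "\<pi> = 1 - \<xi> ^ m"
  define E where "E = pcompose \<theta> (\<xi> ^ s) * \<theta>'"
  define M where "M = (p - 1) * n"
  obtain z where z: "\<Psi> = of_nat p * (1 - \<pi> * z) + \<pi> ^ (p - 1)"
    using cyc_sum_uniformizer[OF prime odd m0] unfolding \<pi>_def by blast
  \<comment> \<open>The minus sign comes from solving \<open>\<Psi> = 0\<close> for
    \<open>\<pi> ^ (p - 1)\<close>.\<close>
  define u0 where "u0 = - (1 - \<pi> * z)"
  define u where "u = u0 ^ n"
  have "of_nat p * u0 \<doteq> \<pi> ^ (p - 1)"
    unfolding eqv_def u0_def z by (rule dvdI[of _ _ "-1"]) (simp add: algebra_simps)
  from eqv_power[OF this, of n] have qu: "of_nat (p ^ n) * u \<doteq> \<pi> ^ M"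
    by (simp add: u_def M_def power_mult_distrib power_mult)
  \<comment> \<open>As \<open>u0\<close> is -1 modulo \<open>\<pi>\<close>, its square is 1 there;
    inverting \<open>u * u\<close> in place of \<open>u\<close> avoids a sign depending on
    \<open>n\<close>.\<close>
  have "\<pi> dvd 1 - u0 ^ 2"
    by (rule dvdI[of _ _ "2 * z - \<pi> * z ^ 2"]) (simp add: u0_def power2_eq_square algebra_simps)
  moreover have "1 - u0 ^ 2 dvd 1 - (u0 ^ 2) ^ n" by (simp add: one_diff_power_eq)
  ultimately obtain z' where "1 - (u0 ^ 2) ^ n = \<pi> * z'" by (meson dvdE dvd_trans)
  moreover have "u * u = (u0 ^ 2) ^ n"
    by (simp add: u_def power2_eq_square power_mult_distrib)
  ultimately have uu: "u * u = 1 - \<pi> * z'" by (metis diff_diff_eq2 add_diff_cancel_left')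
  obtain t where t: "(1 - \<pi> * z') * t = 1 - (\<pi> * z') ^ M"
    using geometric_unit_mod_power by blast
  have unit: "u * (u * t) + \<pi> ^ M * z' ^ M = 1"
    using t unfolding uu [symmetric] by (simp add: power_mult_distrib mult.assoc)
  have "\<theta> * (\<theta>' * \<epsilon> * u) = \<theta> * \<theta>' * \<epsilon> * u" by (simp add: mult.assoc)
  also have "\<dots> \<doteq> of_nat (p ^ n) * \<epsilon> * u" by (intro eqv_mult theta_theta'_eps eqv_refl)
  also have "\<dots> = \<epsilon> * (of_nat (p ^ n) * u)" by (simp add: mult.commute mult.left_commute)
  also have "\<dots> \<doteq> \<epsilon> * \<pi> ^ M" by (intro eqv_mult qu eqv_refl)
  finally have start: "\<Psi> dvd \<theta> * (\<theta>' * \<epsilon> * u) - \<epsilon> * \<pi> ^ M" unfolding eqv_def .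
  have mSuc: "Suc (Suc (m - 1)) = Suc m" using m0 by simp
  \<comment> \<open>Here \<open>g = \<epsilon>\<close> and
    \<open>y = \<theta>' * \<epsilon> * u\<close>, so \<open>\<epsilon>\<close> occurs twice;
    \<open>eps_square\<close> reduces its square. With \<open>r = m - 1\<close> the Frobenius
    exponent is \<open>p ^ n\<close>.\<close>
  have "\<exists>w. \<Psi> dvd \<epsilon> * pcompose \<theta> (\<xi> ^ s) * (\<theta>' * \<epsilon> * u) - \<pi> ^ M * w"
  proof (rule multiplier_divisibility[of \<Psi> \<pi> "m - 1" "\<lambda>f. pcompose f (\<xi> ^ s)"])
    show "\<And>a. \<Psi> dvd \<pi> * a \<Longrightarrow> \<Psi> dvd a"
      unfolding \<pi>_def by (rule cyc_sum_dvd_cancel[OF prime odd m0])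
    show "\<And>f. \<exists>w. \<Psi> dvd f ^ Suc (Suc (m - 1)) - f - \<pi> * w"
      unfolding \<pi>_def mSuc by (rule cyc_sum_frobenius[OF prime odd m0 m])
    show "\<And>f. \<pi> dvd pcompose f (\<xi> ^ s) - f"
      unfolding \<pi>_def by (rule pcompose_indeterminate_power_cong[OF s(1)])
    show "\<Psi> dvd pcompose \<Psi> (\<xi> ^ s)"
      by (rule cyc_sum_dvd_pcompose[OF prime odd m0 s(2)])
  qed (simp_all add: pcompose_diff pcompose_mult start)
  then obtain w where "\<epsilon> * pcompose \<theta> (\<xi> ^ s) * (\<theta>' * \<epsilon> * u) \<doteq> \<pi> ^ M * w"
    unfolding eqv_def by blast
  then have w: "\<epsilon> * \<epsilon> * E * u \<doteq> \<pi> ^ M * w" by (simp add: E_def mult.commute mult.left_commute)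
  define W where "W = w * (u * t) + z' ^ M * (\<epsilon> * \<epsilon> * E)"
  have "of_nat m * \<epsilon> * E \<doteq> \<epsilon> * \<epsilon> * E" by (intro eqv_mult eqv_refl eqv_sym[OF eps_square])
  also have "\<epsilon> * \<epsilon> * E = \<epsilon> * \<epsilon> * E * (u * (u * t) + \<pi> ^ M * z' ^ M)" unfolding unit by simp
  also have "\<dots> = \<epsilon> * \<epsilon> * E * u * (u * t) + \<pi> ^ M * (z' ^ M * (\<epsilon> * \<epsilon> * E))"
    by (simp add: algebra_simps)
  also have "\<dots> \<doteq> \<pi> ^ M * w * (u * t) + \<pi> ^ M * (z' ^ M * (\<epsilon> * \<epsilon> * E))"
    by (intro eqv_add eqv_mult w eqv_refl)
  also have "\<dots> = \<pi> ^ M * W" by (simp add: W_def algebra_simps)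
  also have "\<dots> \<doteq> of_nat (p ^ n) * u * W" by (intro eqv_mult eqv_refl eqv_sym[OF qu])
  finally have mE: "of_nat m * \<epsilon> * E \<doteq> of_nat (p ^ n) * u * W" .
  \<comment> \<open>This rests on \<open>1 + N\<^sub>2 = p ^ n - \<epsilon>\<close> and
    \<open>p ^ n = m + 1\<close>.\<close>
  have "(1 + N\<^sub>2) * E = of_nat m * \<epsilon> * E + of_nat (p ^ n) * (E - \<epsilon> * E)"
    unfolding p_power_poly by (simp add: \<epsilon>_def algebra_simps)
  also have "\<dots> \<doteq> of_nat (p ^ n) * u * W + of_nat (p ^ n) * (E - \<epsilon> * E)"
    by (intro eqv_add mE eqv_refl)
  also have "\<dots> = of_nat (p ^ n) * (u * W + (E - \<epsilon> * E))" by (simp add: algebra_simps)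
  finally show ?thesis unfolding E_def by blast
qed

text \<open>For each pair the exponents \<open>dif s z + p * j\<close> run once through a coset of
  N_2, so \<open>k\<close> is hit exactly when the residues modulo \<open>p\<close> agree.\<close>

lemma N2_mult_eqv:
  "N\<^sub>2 * (pcompose \<theta> (\<xi> ^ s) * \<theta>') \<doteq> (\<Sum>k<m * p. smult (int (corr_p s k)) (\<xi> ^ k))"
proof -
  let ?A = "{..<m} \<times> (S \<times> S)" and ?f = "\<lambda>(j, z). dif s z + p * j"
  have card: "card {a \<in> ?A. ?f a mod (m * p) = k} = corr_p s k" if "k < m * p" for k
  proof -
    let ?B = "\<lambda>z. {j. j < m \<and> (dif s z + p * j) mod (p * m) = k}"
    have "{a \<in> ?A. ?f a mod (m * p) = k} = (\<lambda>(z, j). (j, z)) ` (SIGMA z:S \<times> S. ?B z)"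
      by (auto simp: mult.commute image_iff)
    then have "card {a \<in> ?A. ?f a mod (m * p) = k} = card (SIGMA z:S \<times> S. ?B z)"
      by (simp add: card_image inj_on_def split_beta prod_eq_iff)
    also have "\<dots> = (\<Sum>z\<in>S \<times> S. card (?B z))" by (simp add: finite_S)
    also have "\<dots> = (\<Sum>z\<in>S \<times> S. of_bool (dif s z mod p = k mod p))"
      using m_ge p_pos that by (intro sum.cong card_residue_class_hits) (auto simp: mult.commute)
    also have "\<dots> = corr_p s k"
      by (simp add: corr_p_def of_bool_def sum.If_cases finite_S Int_def)
    finally show ?thesis .
  qed
  have "N\<^sub>2 * (pcompose \<theta> (\<xi> ^ s) * \<theta>') = (\<Sum>a\<in>?A. \<xi> ^ ?f a)"
    unfolding theta_product
    by (subst cyc_sum_def) (simp add: sum_product sum.cartesian_product power_add case_prod_beta mult.commute)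
  also have "\<dots> \<doteq> (\<Sum>k<m * p. smult (int (card {a \<in> ?A. ?f a mod (m * p) = k})) (\<xi> ^ k))"
    by (rule sum_power_eqv) (simp add: finite_S)
  also have "\<dots> = (\<Sum>k<m * p. smult (int (corr_p s k)) (\<xi> ^ k))"
    by (intro sum.cong refl) (simp only: card lessThan_iff)
  finally show ?thesis .
qed

text \<open>The displayed sums are the coefficients of \<open>(1 + N\<^sub>2)\<close> times the
  substituted product, which is divisible by \<open>p ^ n\<close> in T.\<close>

lemma corr_cong:
  assumes s: "s = m * c + 1" "coprime s p"
    and k: "k < m * p" "k' < m * p" "k mod m = k' mod m"
  shows "int (p ^ n) dvd
    (int (corr s k) + int (corr_p s k)) - (int (corr s k') + int (corr_p s k'))"
proof -
  let ?E = "pcompose \<theta> (\<xi> ^ s) * \<theta>'"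
  obtain w where w: "(1 + N\<^sub>2) * ?E \<doteq> of_nat (p ^ n) * w"
    using multiplier_product_divisible[OF s] by blast
  have "(\<Sum>k<m * p. smult (int (corr s k) + int (corr_p s k)) (\<xi> ^ k)) \<doteq> ?E + N\<^sub>2 * ?E"
    unfolding smult_add_left sum.distrib
    by (intro eqv_sym[OF eqv_add] theta_product_eqv N2_mult_eqv)
  also have "\<dots> = (1 + N\<^sub>2) * ?E" by (simp add: distrib_right)
  also have "\<dots> \<doteq> of_nat (p ^ n) * w" by (rule w)
  also have "\<dots> = smult (int (p ^ n)) w" by (simp add: of_nat_poly)
  finally have "\<Psi> dvd (\<Sum>k<m * p. smult (int (corr s k) + int (corr_p s k)) (\<xi> ^ k))
      - smult (int (p ^ n)) w"
    unfolding eqv_def .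
  from coeff_cong_modulo_cyc_sum[OF p_pos _ this k] show ?thesis using m_ge by simp
qed

section \<open>Distribution of D over the cosets of N_2 and N_1\<close>

abbreviation "Q \<equiv> p ^ (n - 1)"

text \<open>The size of the intersection of D with a coset of N_2.\<close>

definition N :: "nat \<Rightarrow> nat" where "N r = card {a \<in> S. a mod p = r}"

lemma sum_N: "(\<Sum>r<p. N r) = m"
  unfolding N_def S(2) [symmetric] using p_pos finite_S by (intro card_collect_fibres) auto

lemma card_fibre_pairs: "card {z \<in> S \<times> S. fst z mod p = r \<and> snd z mod p = r'} = N r * N r'"
proof -
  have "{z \<in> S \<times> S. fst z mod p = r \<and> snd z mod p = r'} =
      {a \<in> S. a mod p = r} \<times> {b \<in> S. b mod p = r'}"
    by auto
  then show ?thesis by (simp add: N_def card_cartesian_product)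
qed

text \<open>Both sides count pairs in a common coset of N_2: \<open>m\<close> diagonal ones, and
  \<open>Q - 1\<close> for each of the \<open>m - 1\<close> nonidentity elements of N_2.\<close>

lemma sum_N_squares: "(\<Sum>r<p. N r * N r) = m + (m - 1) * (Q - 1)"
proof -
  let ?A = "{z \<in> S \<times> S. fst z mod p = snd z mod p}"
  let ?B = "{k. k < m * p \<and> p dvd k}"
  have finA: "finite ?A" using finite_S by simp
  have B: "?B = (\<lambda>j. p * j) ` {..<m}"
    using p_pos by (auto simp: dvd_def mult.commute)
  have cardB: "card ?B = m" unfolding B using p_pos by (simp add: card_image inj_on_def)
  have A: "z \<in> ?A \<longleftrightarrow> p dvd dif 1 z mod (m * p)" if "z \<in> S \<times> S" for z
    using that dif_mod_iff[OF that, of p 1 0] by (simp add: dvd_mod_iff mod_eq_0_iff_dvd)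
  have "(\<Sum>r<p. N r * N r) = (\<Sum>r<p. card {z \<in> ?A. fst z mod p = r})"
    unfolding card_fibre_pairs[symmetric] by (intro sum.cong refl arg_cong[of _ _ card]) auto
  also have "\<dots> = card ?A" using finA p_pos by (intro card_collect_fibres) auto
  also have "\<dots> = (\<Sum>k\<in>?B. card {z \<in> ?A. dif 1 z mod (m * p) = k})"
    using finA v_pos A by (intro card_collect_fibres[symmetric]) auto
  also have "\<dots> = (\<Sum>k\<in>?B. corr 1 k)"
    unfolding corr_def using A by (intro sum.cong refl arg_cong[of _ _ card]) auto
  also have "\<dots> = corr 1 0 + (\<Sum>k\<in>?B - {0}. corr 1 k)"
    using v_pos by (intro sum.remove) auto
  also have "(\<Sum>k\<in>?B - {0}. corr 1 k) = (\<Sum>k\<in>?B - {0}. Q - 1)"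
    using corr_1 not_both_dvd by (intro sum.cong refl) auto
  also have "\<dots> = (m - 1) * (Q - 1)"
    using v_pos cardB by (simp add: card_Diff_singleton)
  finally show ?thesis unfolding corr_1_0 .
qed

lemma int_m: "int m = int p * int Q - 1"
  using arg_cong[OF p_power, of int] by simp

text \<open>The deficits \<open>Q - N r\<close> are integers whose sum and sum of squares are both
  1, so one of them is 1 and the others are 0.\<close>

lemma N_distribution: "\<exists>c<p. \<forall>r<p. int (N r) = int Q - of_bool (r = c)"
proof -
  define d where "d r = int Q - int (N r)" for r
  have Q1: "Q \<ge> 1" using p_pos by (simp add: Suc_leI)
  have sN: "(\<Sum>r<p. int (N r)) = int m" using arg_cong[OF sum_N, of int] by simp
  have s1: "(\<Sum>r<p. d r) = 1"
    using sN int_m by (simp add: d_def sum_subtractf)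
  have "(\<Sum>r<p. d r ^ 2) = (\<Sum>r<p. int Q * int Q - 2 * int Q * int (N r) + int (N r * N r))"
    by (intro sum.cong) (simp_all add: d_def power2_eq_square algebra_simps)
  also have "\<dots> = int p * (int Q * int Q) - 2 * int Q * (\<Sum>r<p. int (N r)) + int (\<Sum>r<p. N r * N r)"
    by (simp only: sum.distrib sum_subtractf sum_distrib_left [symmetric] sum_constant
        card_lessThan of_nat_sum) (simp add: mult.left_commute)
  also have "int (\<Sum>r<p. N r * N r) = int m + (int m - 1) * (int Q - 1)"
    unfolding sum_N_squares using m_ge Q1 by (simp add: of_nat_diff)
  also have "int p * (int Q * int Q) - 2 * int Q * (\<Sum>r<p. int (N r)) + (int m + (int m - 1) * (int Q - 1)) = 1"
    unfolding sN int_m by (simp add: algebra_simps)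
  finally have s2: "(\<Sum>r<p. d r ^ 2) = 1" .
  obtain c where "c < p" "\<forall>r<p. d r = of_bool (r = c)"
    using int_01_of_sum_squares[OF _ s1 s2] by auto
  then show ?thesis by (intro exI[of _ c]) (auto simp: d_def algebra_simps)
qed

text \<open>The relation \<open>P\<close> matches residues bijectively since \<open>s\<close> is
  invertible modulo \<open>p\<close>. Summing the products
  \<open>(Q - [r = c]) * (Q - [u = c])\<close> over matched pairs leaves a constant and one
  indicator, the only part depending on \<open>k\<close>.\<close>

lemma corr_p_eq:
  assumes s: "coprime s p" and c: "c < p" "\<And>r. r < p \<Longrightarrow> int (N r) = int Q - of_bool (r = c)"
  shows "int (corr_p s k) = int p * int Q * int Q - 2 * int Q
    + of_bool (s * c mod p = (c + k) mod p)"
proof -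
  define P where "P r u \<longleftrightarrow> s * r mod p = (u + k) mod p" for r u
  have P1: "(\<Sum>u<p. of_bool (P r u)) = (1 :: int)" for r
    using card_affine_residue[of p 1 "s * r mod p" k] p_pos
    unfolding sum_of_bool_card[OF finite_lessThan] by (simp add: P_def eq_commute)
  have P2: "(\<Sum>r<p. of_bool (P r u)) = (1 :: int)" for u
    using card_affine_residue[of p s "(u + k) mod p" 0] p_pos s
    unfolding sum_of_bool_card[OF finite_lessThan] by (simp add: P_def)
  let ?A = "{z \<in> S \<times> S. dif s z mod p = k mod p}"
  have finA: "finite ?A" using finite_S by simp
  have "corr_p s k = (\<Sum>w\<in>{..<p} \<times> {..<p}. card {z \<in> ?A. (fst z mod p, snd z mod p) = w})"
    unfolding corr_p_def using finA p_pos by (intro card_collect_fibres[symmetric]) auto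
  also have "\<dots> = (\<Sum>w\<in>{..<p} \<times> {..<p}. of_bool (P (fst w) (snd w)) * (N (fst w) * N (snd w)))"
  proof (intro sum.cong refl)
    fix w assume "w \<in> {..<p} \<times> {..<p}"
    have "z \<in> ?A \<and> (fst z mod p, snd z mod p) = w \<longleftrightarrow>
        P (fst w) (snd w) \<and> z \<in> S \<times> S \<and> fst z mod p = fst w \<and> snd z mod p = snd w" for z
    proof (cases "z \<in> S \<times> S")
      case True
      have "P (fst z mod p) (snd z mod p) \<longleftrightarrow> dif s z mod p = k mod p"
        using dif_mod_iff[OF True, of p s k] by (simp add: P_def mod_simps)
      then show ?thesis using True by (cases w) auto
    qed auto
    then have "{z \<in> ?A. (fst z mod p, snd z mod p) = w} =
      (if P (fst w) (snd w) then {z \<in> S \<times> S. fst z mod p = fst w \<and> snd z mod p = snd w} else {})"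
      by (intro equalityI subsetI) (simp_all split: if_splits)
    then show "card {z \<in> ?A. (fst z mod p, snd z mod p) = w} =
        of_bool (P (fst w) (snd w)) * (N (fst w) * N (snd w))"
      by (simp add: card_fibre_pairs)
  qed
  finally have "int (corr_p s k) =
      (\<Sum>r<p. \<Sum>u<p. of_bool (P r u) * (int (N r) * int (N u)))"
    by (simp only: sum.cartesian_product case_prod_unfold of_nat_sum of_nat_mult of_nat_of_bool)
  also have "\<dots> = (\<Sum>r<p. \<Sum>u<p. int (N r) * (int Q * of_bool (P r u) - of_bool (u = c) * of_bool (P r u)))"
    by (intro sum.cong refl) (simp_all add: c(2) algebra_simps)
  also have "\<dots> = (\<Sum>r<p. int (N r) * (int Q - of_bool (P r c)))"
  proof (intro sum.cong refl)
    fix r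
    have "(\<Sum>u<p. of_bool (u = c) * of_bool (P r u)) = (of_bool (P r c) :: int)"
      using c(1) by (intro sum_of_bool_eq_mult) auto
    then show "(\<Sum>u<p. int (N r) * (int Q * of_bool (P r u) - of_bool (u = c) * of_bool (P r u)))
        = int (N r) * (int Q - of_bool (P r c))"
      by (simp only: sum_distrib_left [symmetric] sum_subtractf P1) simp
  qed
  also have "\<dots> = (\<Sum>r<p. int Q * int Q - int Q * of_bool (P r c) - int Q * of_bool (r = c)
      + of_bool (r = c) * of_bool (P r c))"
    by (intro sum.cong refl) (simp_all add: c(2) algebra_simps)
  also have "\<dots> = int p * (int Q * int Q) - int Q * 1 - int Q * 1 + of_bool (P c c)"
  proof -
    have "(\<Sum>r<p. of_bool (r = c)) = (1 :: int)"
      using c(1) sum_of_bool_eq_mult[of "{..<p}" c "\<lambda>_. 1"] by simp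
    moreover have "(\<Sum>r<p. of_bool (r = c) * of_bool (P r c)) = (of_bool (P c c) :: int)"
      using c(1) sum_of_bool_eq_mult[of "{..<p}" c "\<lambda>r. of_bool (P r c)"] by auto
    ultimately show ?thesis
      by (simp only: sum.distrib sum_subtractf sum_distrib_left [symmetric] P2 sum_constant card_lessThan)
        (simp add: mult.left_commute)
  qed
  finally show ?thesis by (simp add: P_def)
qed

text \<open>Two elements of D in one coset of N_1 would have a nonidentity quotient in N_1, which
  \<lambda>_1 = 0 forbids.\<close>

lemma inj_on_mod_m: "inj_on (\<lambda>a. a mod m) S"
proof (rule inj_onI, rule ccontr)
  fix a b assume ab: "a \<in> S" "b \<in> S" "a mod m = b mod m" "a \<noteq> b"
  let ?k = "dif 1 (a, b) mod (m * p)"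
  have z: "(a, b) \<in> S \<times> S" using ab by simp
  have "a < m * p" "b < m * p" using S(1) ab by auto
  then have "?k \<noteq> 0" using dif_mod_iff[OF z dvd_refl, of 1 0] ab by simp
  moreover have "m dvd ?k"
    using dif_mod_iff[OF z, of m 1 0] ab by (simp add: dvd_mod_iff mod_eq_0_iff_dvd)
  moreover have "?k < m * p" using v_pos by simp
  ultimately have "corr 1 ?k = 0" using corr_1[of ?k] by simp
  moreover have "finite {z \<in> S \<times> S. dif 1 z mod (m * p) = ?k}" using finite_S by simp
  ultimately have "{z \<in> S \<times> S. dif 1 z mod (m * p) = ?k} = {}"
    unfolding corr_def by (simp only: card_0_eq)
  then show False using z by blast
qed

lemma image_mod_m: "(\<lambda>a. a mod m) ` S = {..<m}"
  using inj_on_mod_m S(2) m_ge by (intro card_subset_eq) (auto simp: card_image)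

text \<open>The sum counts pairs whose difference has a prescribed residue modulo \<open>m\<close>.
  As \<open>S\<close> represents each residue modulo \<open>m\<close> once, every first component
  admits exactly one partner.\<close>

lemma sum_corr_class:
  "(\<Sum>i<p. corr s ((k + m * i) mod (m * p))) = m"
proof -
  let ?C = "{l. l < m * p \<and> l mod m = k mod m}"
  let ?A = "{z \<in> S \<times> S. dif s z mod m = k mod m}"
  have m0: "m > 0" using m_ge by simp
  have "(\<Sum>i<p. corr s ((k + m * i) mod (m * p))) = (\<Sum>l\<in>?C. corr s l)"
    using bij_betw_residue_class[OF p_pos m0, of k] by (rule sum.reindex_bij_betw)
  also have "\<dots> = (\<Sum>l\<in>?C. card {z \<in> ?A. dif s z mod (m * p) = l})"
    unfolding corr_def by (intro sum.cong refl arg_cong[of _ _ card]) (auto simp: mod_mod_cancel)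
  also have "\<dots> = card ?A"
    using finite_S v_pos by (intro card_collect_fibres) (auto simp: mod_mod_cancel)
  also have "?A = (SIGMA a:S. {b \<in> S. (b + k) mod m = s * a mod m})"
    using dif_mod_iff[of _ m s k] by (auto simp: eq_commute)
  also have "card \<dots> = (\<Sum>a\<in>S. card {b \<in> S. (b + k) mod m = s * a mod m})"
    using finite_S by simp
  also have "\<dots> = (\<Sum>a\<in>S. 1)"
  proof (intro sum.cong refl)
    fix a
    have "(\<lambda>b. b mod m) ` {b \<in> S. (b + k) mod m = s * a mod m} =
        {i. i < m \<and> (1 * i + k) mod m = s * a mod m}"
    proof (intro equalityI subsetI)
      fix i assume i: "i \<in> {i. i < m \<and> (1 * i + k) mod m = s * a mod m}"
      then obtain b where "b \<in> S" "i = b mod m" using image_mod_m by (metis (lifting) imageE lessThan_iff mem_Collect_eq)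
      then show "i \<in> (\<lambda>b. b mod m) ` {b \<in> S. (b + k) mod m = s * a mod m}"
        using i by (auto simp: mod_simps)
    qed (use m0 in \<open>auto simp: mod_simps\<close>)
    then have "card ((\<lambda>b. b mod m) ` {b \<in> S. (b + k) mod m = s * a mod m}) = 1"
      using card_affine_residue[of m 1 "s * a mod m" k] m0 by simp
    moreover have "inj_on (\<lambda>b. b mod m) {b \<in> S. (b + k) mod m = s * a mod m}"
      using inj_on_mod_m by (rule inj_on_subset) auto
    ultimately show "card {b \<in> S. (b + k) mod m = s * a mod m} = 1" by (simp add: card_image)
  qed
  finally show ?thesis using S(2) by simp
qed

section \<open>Exclusion of the flat case and the resulting translate\<close>

text \<open>The exponents 0 and \<open>m\<close> lie in one coset of N_1, but their coefficients are
  \<open>r * (m - 1)\<close> and 0. The coefficient congruence is used with modulus 0, where it is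
  an equality.\<close>

lemma eps_not_eqv_0: "\<not> of_nat r * \<epsilon> \<doteq> 0" if "r > 0"
proof
  assume *: "of_nat r * \<epsilon> \<doteq> 0"
  let ?c = "\<lambda>k. int r * (int m * of_bool (k = 0) - of_bool (p dvd k))"
  have 0: "(\<Sum>k<m * p. smult (int m * of_bool (k = 0)) (\<xi> ^ k)) = of_nat m"
  proof -
    have "(\<Sum>k<m * p. smult (int m * of_bool (k = 0)) (\<xi> ^ k)) =
      (\<Sum>k\<in>{0}. smult (int m) (\<xi> ^ k))"
      using v_pos by (intro sum.mono_neutral_cong_right) auto
    then show ?thesis by (simp add: of_nat_poly)
  qed
  have "(\<Sum>k<m * p. smult (?c k) (\<xi> ^ k)) = smult (int r) \<epsilon>"
    unfolding \<epsilon>_def N2_conv_multiples 0[symmetric] sum_subtractf [symmetric] smult_diff_left [symmetric]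
      smult_sum_right smult_smult ..
  then have "\<Psi> dvd (\<Sum>k<m * p. smult (?c k) (\<xi> ^ k)) - smult 0 0"
    using * by (simp add: eqv_def of_nat_poly)
  from coeff_cong_modulo_cyc_sum[OF p_pos _ this, of 0 m]
  have "0 dvd ?c 0 - ?c m"
    using m_ge prime_gt_1_nat[OF prime] by auto
  moreover have "\<not> p dvd m"
    using coprime_m_p prime by (metis coprime_absorb_right coprime_commute not_prime_unit)
  ultimately show False using m_ge that by auto
qed

text \<open>Such correlations make the product \<open>E\<close> minus a translate of the sum over
  N_2 in T, so \<open>\<epsilon> * E\<close> vanishes. Multiplying by \<open>\<theta>\<close> and
  the substituted \<open>\<theta>'\<close> would give
  \<open>p ^ (2 * n) * \<epsilon> = 0\<close>.\<close>

lemma corr_not_flat: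
  assumes s: "s = m * c0 + 1" "coprime s p"
    and corr: "\<And>k. k < m * p \<Longrightarrow> int (corr s k) = int Q - of_bool (s * c mod p = (c + k) mod p)"
  shows False
proof -
  have m0: "m > 0" using m_ge by simp
  define P where "P k \<longleftrightarrow> s * c mod p = (c + k) mod p" for k
  note corr = corr[folded P_def]
  define E where "E = pcompose \<theta> (\<xi> ^ s) * \<theta>'"
  \<comment> \<open>\<open>P\<close> holds exactly on the coset of N_2 through
    \<open>k0\<close>.\<close>
  obtain k0 where k0: "k0 < p" "(k0 + c) mod p = s * c mod p"
  proof -
    have "card {i. i < p \<and> (1 * i + c) mod p = s * c mod p} = 1"
      using p_pos by (intro card_affine_residue) auto
    then have "{i. i < p \<and> (1 * i + c) mod p = s * c mod p} \<noteq> {}" by (metis card.empty zero_neq_one)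
    then show thesis using that by auto
  qed
  have P_iff: "P k \<longleftrightarrow> k0 mod p = k mod p" for k
  proof -
    have "P k \<longleftrightarrow> [k0 + c = k + c] (mod p)" unfolding P_def cong_def k0(2) by (simp add: add.commute)
    also have "\<dots> \<longleftrightarrow> [k0 = k] (mod p)" by (rule cong_add_rcancel_nat)
    finally show ?thesis by (simp add: cong_def)
  qed
  have "\<xi> ^ k0 * N\<^sub>2 = (\<Sum>j<m. \<xi> ^ (k0 + p * j))"
    by (simp add: cyc_sum_def sum_distrib_left power_add)
  also have "\<dots> \<doteq> (\<Sum>k<m * p. smult (int (card {j \<in> {..<m}. (k0 + p * j) mod (m * p) = k})) (\<xi> ^ k))"
    by (rule sum_power_eqv) simp
  also have "\<dots> = (\<Sum>k<m * p. smult (of_bool (P k)) (\<xi> ^ k))"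
  proof (intro sum.cong refl)
    fix k assume k: "k \<in> {..<m * p}"
    have "card {j. j < m \<and> (k0 + p * j) mod (p * m) = k} = of_bool (k0 mod p = k mod p)"
      using k m0 p_pos by (intro card_residue_class_hits) (auto simp: mult.commute)
    then show "smult (int (card {j \<in> {..<m}. (k0 + p * j) mod (m * p) = k})) (\<xi> ^ k) =
        smult (of_bool (P k)) (\<xi> ^ k)"
      by (simp add: P_iff mult.commute)
  qed
  finally have shift: "\<xi> ^ k0 * N\<^sub>2 \<doteq> (\<Sum>k<m * p. smult (of_bool (P k)) (\<xi> ^ k))" .
  have "E \<doteq> (\<Sum>k<m * p. smult (int (corr s k)) (\<xi> ^ k))" unfolding E_def by (rule theta_product_eqv)
  also have "\<dots> = (\<Sum>k<m * p. smult (int Q) (\<xi> ^ k) - smult (of_bool (P k)) (\<xi> ^ k))"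
    by (intro sum.cong refl) (simp only: lessThan_iff corr smult_diff_left)
  also have "\<dots> = smult (int Q) (\<Sum>k<m * p. \<xi> ^ k) - (\<Sum>k<m * p. smult (of_bool (P k)) (\<xi> ^ k))"
    unfolding sum_subtractf smult_sum_right ..
  also have "\<dots> \<doteq> 0 - \<xi> ^ k0 * N\<^sub>2"
  proof (intro eqv_diff eqv_sym[OF shift])
    show "smult (int Q) (\<Sum>k<m * p. \<xi> ^ k) \<doteq> 0"
      using cyc_sum_dvd_geometric[OF m0, of p] by (simp add: eqv_def dvd_smult)
  qed
  finally have "\<epsilon> * E \<doteq> \<epsilon> * (0 - \<xi> ^ k0 * N\<^sub>2)" by (intro eqv_mult eqv_refl)
  also have "\<dots> = - (\<xi> ^ k0) * (\<epsilon> * N\<^sub>2)" by (simp add: algebra_simps)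
  also have "\<dots> \<doteq> - (\<xi> ^ k0) * 0" by (intro eqv_mult eps_N2 eqv_refl)
  finally have epsE: "\<epsilon> * E \<doteq> 0" by simp
  let ?\<sigma> = "\<lambda>f. pcompose f (\<xi> ^ s)"
  have pc_eqv: "?\<sigma> f \<doteq> ?\<sigma> g" if "f \<doteq> g" for f g
  proof -
    have "?\<sigma> \<Psi> dvd ?\<sigma> (f - g)" using that unfolding eqv_def by (metis dvd_def pcompose_mult)
    then show ?thesis
      using cyc_sum_dvd_pcompose[OF prime odd m0 s(2)] unfolding eqv_def pcompose_diff
      by (rule dvd_trans[rotated])
  qed
  have "?\<sigma> N\<^sub>2 = (\<Sum>j<m. \<xi> ^ (s * (p * j)))"
    unfolding cyc_sum_def pcompose_sum pcompose_indeterminate_power power_mult [symmetric] ..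
  also have "\<dots> \<doteq> (\<Sum>j<m. \<xi> ^ (p * j))"
  proof (intro eqv_sum)
    fix j
    have eq: "s * (p * j) mod (m * p) = p * j mod (m * p)"
    proof -
      have "s * (p * j) = p * j + m * p * (c0 * j)" unfolding s(1) by (simp add: algebra_simps)
      then show ?thesis by (simp only: mod_mult_self2)
    qed
    show "\<xi> ^ (s * (p * j)) \<doteq> \<xi> ^ (p * j)"
      using power_eqv[of "s * (p * j)", unfolded eq]
        eqv_sym[OF power_eqv[of "p * j"]] by (rule eqv_trans)
  qed
  finally have "?\<sigma> N\<^sub>2 \<doteq> N\<^sub>2" by (simp add: cyc_sum_def)
  moreover have pc_nat: "?\<sigma> (of_nat r) = of_nat r" for r
    by (simp add: of_nat_poly)
  ultimately have sigma_eps: "?\<sigma> \<epsilon> \<doteq> \<epsilon>"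
    unfolding \<epsilon>_def pcompose_diff by (simp add: eqv_diff)
  \<comment> \<open>One factor \<open>p ^ n\<close> is expanded through the substituted identity for
    \<open>\<theta> * \<theta>' * \<epsilon>\<close>, the other through the original one; the
    substitution fixes \<open>\<epsilon>\<close> in T.\<close>
  have "of_nat (p ^ n) * (of_nat (p ^ n) * \<epsilon>) \<doteq> of_nat (p ^ n) * (of_nat (p ^ n) * ?\<sigma> \<epsilon>)"
    by (intro eqv_mult eqv_refl eqv_sym[OF sigma_eps])
  also have "\<dots> = of_nat (p ^ n) * ?\<sigma> (of_nat (p ^ n) * \<epsilon>)"
    unfolding pcompose_mult pc_nat ..
  also have "\<dots> \<doteq> of_nat (p ^ n) * ?\<sigma> (\<theta> * \<theta>' * \<epsilon>)"
    by (intro eqv_mult eqv_refl pc_eqv eqv_sym[OF theta_theta'_eps])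
  also have "\<dots> = of_nat (p ^ n) * (?\<sigma> \<theta> * ?\<sigma> \<theta>' * ?\<sigma> \<epsilon>)" unfolding pcompose_mult ..
  also have "\<dots> \<doteq> of_nat (p ^ n) * (?\<sigma> \<theta> * ?\<sigma> \<theta>' * \<epsilon>)"
    by (intro eqv_mult eqv_refl sigma_eps)
  also have "\<dots> = (?\<sigma> \<theta> * ?\<sigma> \<theta>') * (of_nat (p ^ n) * \<epsilon>)" by (simp only: ac_simps)
  also have "\<dots> \<doteq> (?\<sigma> \<theta> * ?\<sigma> \<theta>') * (\<theta> * \<theta>' * \<epsilon>)" by (intro eqv_mult eqv_refl eqv_sym[OF theta_theta'_eps])
  also have "\<dots> = (?\<sigma> \<theta>' * \<theta>) * (\<epsilon> * E)" unfolding E_def by (simp only: ac_simps)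
  also have "\<dots> \<doteq> (?\<sigma> \<theta>' * \<theta>) * 0" by (intro eqv_mult eqv_refl epsE)
  finally have "of_nat (p ^ n * p ^ n) * \<epsilon> \<doteq> 0" by (simp only: of_nat_mult mult.assoc mult_zero_right)
  then show False using eps_not_eqv_0[of "p ^ n * p ^ n"] p_pos by simp
qed

text \<open>The corrected correlation \<open>e\<close> has sum \<open>p ^ n\<close> on each coset of
  N_1 and is constant modulo \<open>p ^ n\<close> there. It cannot be flat on every coset, so it
  takes the value \<open>p ^ n\<close> at some \<open>k\<close>, the required translation.\<close>

lemma multiplier_translate:
  assumes s: "s = m * c0 + 1" "coprime s p"
  shows "\<exists>k. (\<lambda>a. s * a mod (m * p)) ` S = (\<lambda>b. (b + k) mod (m * p)) ` S"
proof -
  obtain c where c: "c < p" "\<And>r. r < p \<Longrightarrow> int (N r) = int Q - of_bool (r = c)"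
    using N_distribution by blast
  define P where "P k \<longleftrightarrow> s * c mod p = (c + k) mod p" for k
  define e where "e k = int (corr s k) + of_bool (P k)" for k
  have m0: "m > 0" using m_ge by simp
  have e_cong: "int (p ^ n) dvd e k - e k'" if "k < m * p" "k' < m * p" "k mod m = k' mod m" for k k'
  proof -
    have "e k - e k' = (int (corr s k) + int (corr_p s k)) - (int (corr s k') + int (corr_p s k'))"
      using corr_p_eq[OF s(2) c, of k] corr_p_eq[OF s(2) c, of k'] unfolding e_def P_def by linarith
    then show ?thesis using corr_cong[OF s that] by (simp only:)
  qed
  have sum_e: "(\<Sum>i<p. e ((k + m * i) mod (m * p))) = int (p ^ n)" for k
  proof -
    have "P ((k + m * i) mod (m * p)) \<longleftrightarrow> (m * i + (c + k)) mod p = s * c mod p" for i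
    proof -
      have "((k + m * i) mod (m * p)) mod p = (k + m * i) mod p" by (simp add: mod_mod_cancel)
      then show ?thesis unfolding P_def by (metis add.commute add.left_commute mod_add_right_eq)
    qed
    \<comment> \<open>Because \<open>m\<close> and \<open>p\<close> are coprime, a coset of N_1
      meets the coset of N_2 cut out by \<open>P\<close> exactly once; this raises the sum from
      \<open>m\<close> to \<open>m + 1 = p ^ n\<close>.\<close>
    then have "(\<Sum>i<p. of_bool (P ((k + m * i) mod (m * p)))) = int 1"
      using card_affine_residue[of p m "s * c mod p" "c + k"] p_pos coprime_m_p
      unfolding sum_of_bool_card[OF finite_lessThan] by simp
    then show ?thesis
      using arg_cong[OF sum_corr_class[of s k], of int] m by (simp add: e_def sum.distrib)
  qed
  have alternatives: "(\<exists>k<m * p. e k = int (p ^ n)) \<or> (\<forall>k<m * p. int p * e k = int (p ^ n))"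
  proof (rule disjCI)
    assume no: "\<not> (\<forall>k<m * p. int p * e k = int (p ^ n))"
    then obtain k where k: "k < m * p" "int p * e k \<noteq> int (p ^ n)" by blast
    let ?h = "\<lambda>i. (k + m * i) mod (m * p)"
    have "(\<exists>i\<in>{..<p}. e (?h i) = int (p ^ n)) \<or> (\<forall>i\<in>{..<p}. int (card {..<p}) * e (?h i) = int (p ^ n))"
    proof (rule congruent_nonneg_sum_eq_modulus)
      show "int (p ^ n) dvd e (?h i) - e (?h j)" for i j
        by (rule e_cong) (use v_pos in \<open>auto simp: mod_mod_cancel\<close>)
      show "e (?h i) \<ge> 0" for i by (simp add: e_def)
      show "(\<Sum>i<p. e (?h i)) = int (p ^ n)" by (rule sum_e)
      show "int (p ^ n) > 0" using p_pos by simp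
    qed simp
    moreover have "\<not> (\<forall>i\<in>{..<p}. int (card {..<p}) * e (?h i) = int (p ^ n))"
    proof
      assume "\<forall>i\<in>{..<p}. int (card {..<p}) * e (?h i) = int (p ^ n)"
      then have "int (card {..<p}) * e (?h 0) = int (p ^ n)" using p_pos by blast
      then show False using k by simp
    qed
    ultimately have "\<exists>i\<in>{..<p}. e (?h i) = int (p ^ n)" by blast
    then obtain i where "e (?h i) = int (p ^ n)" by blast
    moreover have "?h i < m * p" using v_pos by simp
    ultimately show "\<exists>k<m * p. e k = int (p ^ n)" by blast
  qed
  have "\<exists>k<m * p. e k = int (p ^ n)"
  proof (rule ccontr)
    assume "\<not> (\<exists>k<m * p. e k = int (p ^ n))"
    then have all: "\<forall>k<m * p. int p * e k = int (p ^ n)" using alternatives by blast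
    have corr: "int (corr s k) = int Q - of_bool (P k)" if "k < m * p" for k
    proof -
      have "int p * e k = int p * int Q"
        using all that p_power m by (metis of_nat_mult)
      then show ?thesis using p_pos by (simp add: e_def)
    qed
    then show False using corr_not_flat[OF s] unfolding P_def by blast
  qed
  then obtain k where k: "k < m * p" "e k = int (p ^ n)" by blast
  \<comment> \<open>The correction is at most 1, so at least \<open>m\<close> pairs have difference
    \<open>k\<close>. That is as many as \<open>S\<close> has elements, so every element of
    \<open>S\<close> occurs as a first component.\<close>
  then have corr: "corr s k \<ge> m" using m by (cases "P k") (auto simp: e_def)
  define A where "A = {z \<in> S \<times> S. dif s z mod (m * p) = k}"
  have eqA: "s * fst z mod (m * p) = (snd z + k) mod (m * p)" if "z \<in> A" for z
    using that dif_mod_iff[of z "m * p" s k] k by (simp add: A_def)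
  have "inj_on fst A"
  proof (rule inj_onI)
    fix z z' assume z: "z \<in> A" "z' \<in> A" "fst z = fst z'"
    then have "[snd z + k = snd z' + k] (mod (m * p))" using eqA by (metis cong_def)
    then have "snd z mod (m * p) = snd z' mod (m * p)" unfolding cong_add_rcancel_nat by (simp add: cong_def)
    moreover have "snd z < m * p" "snd z' < m * p" using z S(1) unfolding A_def by auto
    ultimately show "z = z'" using z(3) by (simp add: prod_eq_iff)
  qed
  then have "card (fst ` A) \<ge> card S" using corr S(2) by (simp add: card_image corr_def A_def)
  moreover have "fst ` A \<subseteq> S" unfolding A_def by auto
  ultimately have fstA: "fst ` A = S" using finite_S card_seteq by blast
  let ?l = "\<lambda>a. s * a mod (m * p)" and ?r = "\<lambda>b. (b + k) mod (m * p)"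
  have sub: "?l ` S \<subseteq> ?r ` S"
  proof
    fix w assume "w \<in> ?l ` S"
    then obtain z where "z \<in> A" "w = s * fst z mod (m * p)" using fstA by blast
    then show "w \<in> ?r ` S" using eqA by (auto simp: A_def)
  qed
  \<comment> \<open>Since \<open>s\<close> is 1 modulo \<open>m\<close>, this reduces to injectivity
    of reduction modulo \<open>m\<close> on \<open>S\<close>.\<close>
  have "inj_on ?l S"
  proof (rule inj_onI)
    fix a b assume ab: "a \<in> S" "b \<in> S" "?l a = ?l b"
    have s_mod: "s * a mod m = a mod m" for a
    proof -
      have "s * a = a + m * (c0 * a)" unfolding s(1) by (simp add: algebra_simps)
      then show ?thesis by (simp only: mod_mult_self2)
    qed
    have "s * a mod m = s * b mod m" using arg_cong[OF ab(3), of "\<lambda>w. w mod m"] by (simp add: mod_mod_cancel)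
    then have "a mod m = b mod m" unfolding s_mod .
    then show "a = b" using inj_on_mod_m ab by (auto dest: inj_onD)
  qed
  then have "card (?r ` S) \<le> card (?l ` S)" using finite_S by (simp add: card_image card_image_le)
  then have "?l ` S = ?r ` S" using sub finite_S by (intro card_seteq) auto
  then show ?thesis by blast
qed

end

section \<open>Transfer to the direct product\<close>

text \<open>\<open>HOL-Algebra\<close> defines \<open>mult_of\<close> twice.\<close>

lemma mult_of_eq: "Ring_Divisibility.mult_of R = Multiplicative_Group.mult_of R"
  by (simp add: Ring_Divisibility.mult_of_def Multiplicative_Group.mult_of_def)

lemma (in group) nat_pow_eq_iff:
  assumes "a \<in> carrier G"
  shows "a [^] (i::nat) = a [^] (j::nat) \<longleftrightarrow> i mod ord a = j mod ord a"
proof -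
  have "a [^] i = a [^] j \<longleftrightarrow> a [^] int i = a [^] int j" by (simp add: int_pow_int)
  also have "\<dots> \<longleftrightarrow> int (ord a) dvd int j - int i" using assms by (rule int_pow_eq)
  also have "\<dots> \<longleftrightarrow> int j mod int (ord a) = int i mod int (ord a)"
    by (rule mod_eq_dvd_iff [symmetric])
  also have "\<dots> \<longleftrightarrow> i mod ord a = j mod ord a"
    unfolding zmod_int [symmetric] of_nat_eq_iff by (rule eq_commute)
  finally show ?thesis .
qed

lemma (in group) ord_generator:
  assumes "finite (carrier G)" "a \<in> carrier G" "carrier G = {a [^] i | i::nat. i \<in> UNIV}"
  shows "ord a = Coset.order G"
proof -
  have "carrier G = (\<lambda>i. a [^] i) ` {0..ord a - 1}"
    using ord_elems[OF assms(1,2)] assms(3) by auto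
  then have "Coset.order G = card {0..ord a - 1}"
    using ord_inj[OF assms(2)] by (metis card_image Coset.order_def)
  then show ?thesis using ord_ge_1[OF assms(1,2)] by simp
qed

lemma (in group) carrier_eq_powers:
  assumes "finite (carrier G)" "a \<in> carrier G" "ord a = Coset.order G"
  shows "carrier G = (\<lambda>i::nat. a [^] i) ` {..<Coset.order G}"
proof -
  have "inj_on (\<lambda>i::nat. a [^] i) {..<Coset.order G}"
    using assms by (auto intro!: inj_onI simp: nat_pow_eq_iff)
  then have "card ((\<lambda>i::nat. a [^] i) ` {..<Coset.order G}) = card (carrier G)"
    by (simp add: card_image Coset.order_def)
  moreover have "(\<lambda>i::nat. a [^] i) ` {..<Coset.order G} \<subseteq> carrier G" using assms(2) by auto
  ultimately show ?thesis using card_subset_eq[OF assms(1)] by blast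
qed

lemma nat_pow_DirProd: "(a, b) [^]\<^bsub>A \<times>\<times> B\<^esub> (k::nat) = (a [^]\<^bsub>A\<^esub> k, b [^]\<^bsub>B\<^esub> k)"
  by (induction k) (simp_all add: nat_pow_def)

lemma ord_DirProd_coprime:
  assumes "group A" "group B" "a \<in> carrier A" "b \<in> carrier B"
    and "coprime (group.ord A a) (group.ord B b)"
  shows "group.ord (A \<times>\<times> B) (a, b) = group.ord A a * group.ord B b"
proof -
  interpret A: group A by fact
  interpret B: group B by fact
  interpret G: group "A \<times>\<times> B" by (rule DirProd_group) fact+
  show ?thesis
    using assms(3-) by (subst G.ord_unique)
      (auto simp: nat_pow_DirProd A.pow_eq_id B.pow_eq_id intro: divides_mult dvd_mult_left dvd_mult_right)
qed

theorem theorem5p3: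
  fixes K :: "('a, 'm) ring_scheme" and F :: "('b, 'n) ring_scheme"
    and p n :: nat and D :: "('a \<times> 'b) set"
  assumes "Factorial_Ring.prime p" and "odd p" and "n \<ge> 1"
    and "field K" and "card (carrier K) = p ^ n"
    and "field F" and "card (carrier F) = p"
    and "generalized_difference_set (mult_add_group K F)
           ({\<one>\<^bsub>K\<^esub>} \<times> carrier F) ((carrier K - {\<zero>\<^bsub>K\<^esub>}) \<times> {\<zero>\<^bsub>F\<^esub>})
           (p * (p ^ n - 1)) p (p ^ n - 1) (p ^ n - 1) (p ^ (n - 1)) 0 (p ^ (n - 1) - 1) D"
  shows "\<forall>i \<in> {1..p - 1}. numerical_multiplier_1 K F (int (p + i * (p ^ n - 1))) D"
proof
  fix i assume i: "i \<in> {1..p - 1}"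
  interpret K: field K by fact
  interpret F: field F by fact
  define m where "m = p ^ n - 1"
  have p1: "p > 1" using assms(1) by (rule prime_gt_1_nat)
  then have m: "p ^ n = Suc m" unfolding m_def by simp
  define G where "G = Multiplicative_Group.mult_of K \<times>\<times> add_monoid F"
  have G_eq: "mult_add_group K F = G" by (simp add: G_def mult_add_group_def mult_of_eq)
  interpret A: group "Multiplicative_Group.mult_of K" by (rule K.field_mult_group)
  have B: "group (add_monoid F)" by (rule F.add.is_group)
  interpret G: group G unfolding G_def by (rule DirProd_group[OF A.group_axioms B])
  note gds = assms(8)[unfolded G_eq generalized_difference_set_def Let_def, folded m_def]
  have finG: "finite (carrier G)" and ordG: "Coset.order G = m * p"
    and D: "D \<subseteq> carrier G" "card D = m"
    using gds by (auto simp: mult.commute)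
  have finK: "finite (carrier K)" using assms(5) p1 by (metis card.infinite not_one_less_zero power_not_zero less_irrefl)
  obtain \<gamma> where \<gamma>: "\<gamma> \<in> carrier (Multiplicative_Group.mult_of K)"
      "carrier (Multiplicative_Group.mult_of K) = {\<gamma> [^]\<^bsub>K\<^esub> i | i::nat. i \<in> UNIV}"
    using K.finite_field_mult_group_has_gen[OF finK] by blast
  have ord\<gamma>: "A.ord \<gamma> = m"
  proof -
    have "A.ord \<gamma> = Coset.order (Multiplicative_Group.mult_of K)"
      using \<gamma> by (intro A.ord_generator K.finite_mult_of finK) (simp_all only: Multiplicative_Group.nat_pow_mult_of)
    then show ?thesis using assms(5) by (simp add: K.order_mult_of[OF finK] m_def Coset.order_def)
  qed
  \<comment> \<open>In an additive group of prime order any nonzero element is a generator.\<close>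
  define \<delta> where "\<delta> = \<one>\<^bsub>F\<^esub>"
  have \<delta>: "\<delta> \<in> carrier (add_monoid F)" by (simp add: \<delta>_def)
  have ord\<delta>: "group.ord (add_monoid F) \<delta> = p"
  proof -
    have "group.ord (add_monoid F) \<delta> dvd p"
      using group.ord_dvd_group_order[OF B \<delta>] assms(7) by (simp add: Coset.order_def)
    moreover have "group.ord (add_monoid F) \<delta> \<noteq> 1" using group.ord_eq_1[OF B \<delta>] by (simp add: \<delta>_def)
    ultimately show ?thesis using assms(1) by (metis prime_nat_iff)
  qed
  have "coprime (p ^ n) m" unfolding m by simp
  then have cop: "coprime m p" using assms(3) by (simp add: coprime_commute)
  define g where "g = (\<gamma>, \<delta>)"
  have g: "g \<in> carrier G" using \<gamma>(1) \<delta> by (simp add: g_def G_def)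
  have ordg: "G.ord g = m * p"
    unfolding g_def G_def using \<gamma>(1) \<delta> cop
    by (subst ord_DirProd_coprime) (simp_all add: A.group_axioms B ord\<gamma> ord\<delta>)
  define \<phi> :: "nat \<Rightarrow> 'a \<times> 'b" where "\<phi> k = g [^]\<^bsub>G\<^esub> k" for k
  have \<phi>_pair: "\<phi> k = (\<gamma> [^]\<^bsub>Multiplicative_Group.mult_of K\<^esub> k, \<delta> [^]\<^bsub>add_monoid F\<^esub> k)" for k
    by (simp add: \<phi>_def g_def G_def nat_pow_DirProd)
  have \<phi>_eq: "\<phi> k = \<phi> l \<longleftrightarrow> k mod (m * p) = l mod (m * p)" for k l
    unfolding \<phi>_def ordg[symmetric] by (rule G.nat_pow_eq_iff[OF g])
  have \<phi>_carrier: "\<phi> k \<in> carrier G" for k using g by (simp add: \<phi>_def)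
  have \<phi>_add: "\<phi> (k + l) = \<phi> k \<otimes>\<^bsub>G\<^esub> \<phi> l" for k l
    using g by (simp add: \<phi>_def G.nat_pow_mult)
  have \<phi>_surj: "carrier G = \<phi> ` {..<m * p}"
    using G.carrier_eq_powers[OF finG g] ordg ordG unfolding \<phi>_def by simp
  define S where "S = {k. k < m * p \<and> \<phi> k \<in> D}"
  have D_img: "D = \<phi> ` S" using D(1) \<phi>_surj unfolding S_def by auto
  have inj: "inj_on \<phi> S" by (rule inj_onI) (auto simp: S_def \<phi>_eq)
  have cardS: "card S = m" using D(2) card_image[OF inj] by (simp add: D_img)
  have one_fst: "fst (\<phi> k) = \<one>\<^bsub>K\<^esub> \<longleftrightarrow> m dvd k" for k
    using A.pow_eq_id[OF \<gamma>(1), of k] by (simp add: \<phi>_pair ord\<gamma>)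
  have zero_snd: "snd (\<phi> k) = \<zero>\<^bsub>F\<^esub> \<longleftrightarrow> p dvd k" for k
    using group.pow_eq_id[OF B \<delta>, of k] by (simp add: \<phi>_pair ord\<delta>)
  have \<phi>_one: "\<phi> k = \<one>\<^bsub>G\<^esub> \<longleftrightarrow> m * p dvd k" for k
    using G.pow_eq_id[OF g, of k] by (simp add: \<phi>_def ordg)
  \<comment> \<open>Exponentiation by \<open>g\<close> identifies the residues modulo
    \<open>m * p\<close> with G and turns quotients of elements of D into differences of
    exponents.\<close>
  interpret cyclic_difference_set p n m S
  proof
    fix k assume k: "0 < k" "k < m * p"
    have ne: "\<phi> k \<noteq> \<one>\<^bsub>G\<^esub>" using k by (simp add: \<phi>_one nat_dvd_not_less)
    let ?Z = "{z \<in> S \<times> S. (fst z + (m * p - snd z)) mod (m * p) = k}"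
    let ?L = "{(d1, d2). d1 \<in> D \<and> d2 \<in> D \<and> d1 \<noteq> d2 \<and> d1 \<otimes>\<^bsub>G\<^esub> inv\<^bsub>G\<^esub> d2 = \<phi> k}"
    have iff: "(a + (m * p - b)) mod (m * p) = k \<longleftrightarrow>
        \<phi> a \<noteq> \<phi> b \<and> \<phi> a \<otimes>\<^bsub>G\<^esub> inv\<^bsub>G\<^esub> \<phi> b = \<phi> k" if "b \<in> S" for a b
    proof -
      have b: "b < m * p" using that by (simp add: S_def)
      have "\<phi> (m * p - b) \<otimes>\<^bsub>G\<^esub> \<phi> b = \<one>\<^bsub>G\<^esub>"
        using b by (simp add: \<phi>_add[symmetric] \<phi>_one)
      then have "inv\<^bsub>G\<^esub> \<phi> b = \<phi> (m * p - b)" using G.inv_equality \<phi>_carrier by blast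
      then have "\<phi> a \<otimes>\<^bsub>G\<^esub> inv\<^bsub>G\<^esub> \<phi> b = \<phi> (a + (m * p - b))" by (simp add: \<phi>_add)
      moreover have "\<phi> a \<otimes>\<^bsub>G\<^esub> inv\<^bsub>G\<^esub> \<phi> b \<noteq> \<phi> k" if "\<phi> a = \<phi> b"
        using that ne \<phi>_carrier by (simp add: G.r_inv)
      ultimately show ?thesis using k by (auto simp: \<phi>_eq)
    qed
    have "?L = (\<lambda>(a, b). (\<phi> a, \<phi> b)) ` ?Z"
    proof (intro equalityI subsetI)
      fix w assume "w \<in> ?L"
      then obtain d1 d2 where d: "w = (d1, d2)" "d1 \<in> D" "d2 \<in> D"
          "d1 \<noteq> d2 \<and> d1 \<otimes>\<^bsub>G\<^esub> inv\<^bsub>G\<^esub> d2 = \<phi> k"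
        by blast
      then obtain a b where ab: "a \<in> S" "b \<in> S" "d1 = \<phi> a" "d2 = \<phi> b"
        unfolding D_img by blast
      then have "(a, b) \<in> ?Z" using iff[of b a] d(4) by simp
      then show "w \<in> (\<lambda>(a, b). (\<phi> a, \<phi> b)) ` ?Z" using d(1) ab by force
    next
      fix w assume "w \<in> (\<lambda>(a, b). (\<phi> a, \<phi> b)) ` ?Z"
      then obtain a b where "a \<in> S" "b \<in> S" "w = (\<phi> a, \<phi> b)" "(a + (m * p - b)) mod (m * p) = k"
        by auto
      then show "w \<in> ?L" using iff[of b a] unfolding D_img by blast
    qed
    moreover have "inj_on (\<lambda>(a, b). (\<phi> a, \<phi> b)) ?Z"
      using inj by (auto simp: inj_on_def)
    ultimately have card: "card ?Z = card ?L" by (simp add: card_image)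
    have \<phi>k: "fst (\<phi> k) \<in> carrier K - {\<zero>\<^bsub>K\<^esub>}" "snd (\<phi> k) \<in> carrier F"
      using \<phi>_carrier[of k] by (auto simp: G_def)
    have N1: "\<phi> k \<in> {\<one>\<^bsub>K\<^esub>} \<times> carrier F \<longleftrightarrow> m dvd k"
      using one_fst[of k] \<phi>k by (auto simp: mem_Times_iff)
    have N2: "\<phi> k \<in> (carrier K - {\<zero>\<^bsub>K\<^esub>}) \<times> {\<zero>\<^bsub>F\<^esub>} \<longleftrightarrow> p dvd k"
      using zero_snd[of k] \<phi>k by (auto simp: mem_Times_iff)
    show "card ?Z = (if m dvd k then 0 else if p dvd k then p ^ (n - 1) - 1 else p ^ (n - 1))"
      unfolding card using gds N1 N2 ne \<phi>_carrier[of k] by auto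
  qed (use assms(1-3) m cardS in \<open>auto simp: S_def\<close>)
  \<comment> \<open>Chosen so that \<open>s\<close> is 1 modulo \<open>m\<close> and congruent to
    \<open>t\<close> modulo \<open>p\<close>: taking s-th powers in G fixes the first component and
    scales the second by \<open>t\<close>.\<close>
  define s where "s = m * (i + 1) + 1"
  define t where "t = p + i * m"
  have s_t: "s + p = t + p ^ n" unfolding s_def t_def m by (simp add: algebra_simps)
  have st: "s mod p = t mod p"
  proof -
    have "(s + p) mod p = (t + p ^ n) mod p" unfolding s_t ..
    moreover have "p ^ n mod p = 0" using assms(3) by (simp add: mod_eq_0_iff_dvd)
    ultimately show ?thesis by (metis add.right_neutral mod_add_right_eq mod_add_self2)
  qed
  \<comment> \<open>Otherwise \<open>p\<close> would divide \<open>i * m\<close> and hence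
    \<open>i\<close>, against \<open>1 \<le> i \<le> p - 1\<close>.\<close>
  have "coprime s p"
  proof (rule ccontr)
    assume "\<not> coprime s p"
    then have "p dvd s" using assms(1) by (metis coprime_commute prime_imp_coprime)
    then have "p dvd p + i * m" using st unfolding t_def by (simp add: mod_eq_0_iff_dvd[symmetric])
    then have "p dvd i * m" by simp
    then have "p dvd i" using cop by (simp add: coprime_commute coprime_dvd_mult_left_iff)
    then show False using i by (auto dest: dvd_imp_le)
  qed
  then obtain k where k: "(\<lambda>a. s * a mod (m * p)) ` S = (\<lambda>b. (b + k) mod (m * p)) ` S"
    using multiplier_translate[of s "i + 1"] by (auto simp: s_def)
  have \<phi>_mod: "\<phi> (l mod (m * p)) = \<phi> l" for l by (simp add: \<phi>_eq)
  have scale: "(\<lambda>(x, y). (x, [int t] \<cdot>\<^bsub>F\<^esub> y)) (\<phi> a) = \<phi> (s * a)" for a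
  proof -
    have "s * a = a + m * ((i + 1) * a)" unfolding s_def by (simp add: algebra_simps)
    then have "s * a mod m = a mod m" by (simp only: mod_mult_self2)
    then have "\<gamma> [^]\<^bsub>Multiplicative_Group.mult_of K\<^esub> (s * a) = \<gamma> [^]\<^bsub>Multiplicative_Group.mult_of K\<^esub> a"
      using A.nat_pow_eq_iff[OF \<gamma>(1)] by (simp only: ord\<gamma>)
    moreover have "a * t mod p = s * a mod p" using st by (metis mod_mult_cong mult.commute)
    then have "\<delta> [^]\<^bsub>add_monoid F\<^esub> (a * t) = \<delta> [^]\<^bsub>add_monoid F\<^esub> (s * a)"
      using group.nat_pow_eq_iff[OF B \<delta>] by (simp only: ord\<delta>)
    then have "[int t] \<cdot>\<^bsub>F\<^esub> (\<delta> [^]\<^bsub>add_monoid F\<^esub> a) = \<delta> [^]\<^bsub>add_monoid F\<^esub> (s * a)"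
      unfolding add_pow_def int_pow_int monoid.nat_pow_pow[OF group.is_monoid[OF B] \<delta>] .
    ultimately show ?thesis by (simp add: \<phi>_pair)
  qed
  have "scale_second F (int t) D = (\<lambda>a. \<phi> (s * a)) ` S"
    unfolding scale_second_def D_img image_image scale ..
  also have "\<dots> = \<phi> ` ((\<lambda>a. s * a mod (m * p)) ` S)" by (simp only: image_image \<phi>_mod)
  also have "\<dots> = (\<lambda>b. \<phi> (k + b)) ` S" unfolding k by (simp only: image_image \<phi>_mod add.commute)
  also have "\<dots> = \<phi> k <#\<^bsub>G\<^esub> D" unfolding l_coset_def D_img by (auto simp: \<phi>_add)
  finally show "numerical_multiplier_1 K F (int (p + i * (p ^ n - 1))) D"
    unfolding numerical_multiplier_1_def G_eq t_def m_def using \<phi>_carrier by blast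
qed

end
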